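(* Let $\mathcal{X}=\mathbb{C}[x,y]$ with its $\mathcal{U}(\mathrm{sl}_2)$-action $\rho$, and let $\mathcal{X}_\hbar=\mathbb{C}\langle\hat{x},\hat{y}\rangle[[\hbar]]/\langle\hat{x}\hat{y}=\mathrm{e}^{\hbar}\hat{y}\hat{x}\rangle$ be the quantum plane with its $\mathcal{U}_\hbar(\mathrm{sl}_2)$-action $\rho_\hbar$. Let $\alpha:\mathcal{U}(\mathrm{sl}_2)[[\hbar]]\to\mathcal{U}_\hbar(\mathrm{sl}_2)$ be the isomorphism of $\hbar$-adic algebras described in the context. Then the $\mathbb{C}[[\hbar]]$-linear ($\hbar$-adically continuous) map $\varphi:\mathcal{X}[[\hbar]]\to\mathcal{X}_\hbar$ defined by $$\varphi(x^k y^l)=\genfrac{[}{]}{0pt}{}{k+l}{k}_{q^{-2}}^{1/2}\binom{k+l}{k}^{-1/2}\hat{x}^k\hat{y}^l\qquad(k,l\in\mathbb{N}_0)$$ is a symmetry preserving ordering prescription: it is an isomorphism of $\mathbb{C}[[\hbar]]$-modules, and $$\varphi^{-1}\circ\rho_\hbar\circ(\alpha\otimes\varphi)=\rho .$$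
   Context: Here $q=\mathrm{e}^{\hbar}$; $[a]:=\frac{\mathrm{e}^{\hbar a}-\mathrm{e}^{-\hbar a}}{\mathrm{e}^{\hbar}-\mathrm{e}^{-\hbar}}$, an $\hbar$-adic series in the indeterminate $a$; $[n]!:=[1][2]\cdots[n]$; and $$\genfrac{[}{]}{0pt}{}{n}{k}_{q^{-2}}:=\mathrm{e}^{\hbar k(k-n)}\frac{[n]!}{[n-k]!\,[k]!}.$$ Square roots of power series in $\hbar$ with positive constant term are those with positive constant term. Undeformed symmetry: $\mathcal{U}(\mathrm{sl}_2)$ has generators $E,H,F$ with $[H,E]=2E$, $[H,F]=-2F$, $[E,F]=H$. The action $\rho$ on $\mathcal{X}$ is by the derivations $E=y\partial_x$, $H=y\partial_y-x\partial_x$, $F=x\partial_y$, extended $\mathbb{C}[[\hbar]]$-linearly. Deformed symmetry: $\mathcal{U}_\hbar(\mathrm{sl}_2)$ is the $\hbar$-adic algebra with generators $\hat{E},\hat{H},\hat{F}$ and relations $[\hat{H},\hat{E}]=2\hat{E}$, $[\hat{H},\hat{F}]=-2\hat{F}$, $[\hat{E},\hat{F}]=\frac{\mathrm{e}^{\hbar\hat{H}}-\mathrm{e}^{-\hbar\hat{H}}}{\mathrm{e}^{\hbar}-\mathrm{e}^{-\hbar}}$. The action $\rho_\hbar$, written $\triangleright$, on $\mathcal{X}_\hbar$ is determined as follows. On generators, $$\hat{H}\triangleright\hat{x}=-\hat{x},\quad \hat{H}\triangleright\hat{y}=\hat{y},\quad \hat{E}\triangleright\hat{x}=\mathrm{e}^{\hbar/2}\hat{y},\quad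 \hat{E}\triangleright\hat{y}=0,\quad \hat{F}\triangleright\hat{y}=\mathrm{e}^{-\hbar/2}\hat{x},\quad \hat{F}\triangleright\hat{x}=0 .$$ All generators annihilate $1$, $\hat{H}$ acts as a derivation, and $$\hat{E}\triangleright(pp')=(\hat{E}\triangleright p)(\mathrm{e}^{\hbar\hat{H}}\triangleright p')+p(\hat{E}\triangleright p'),\qquad \hat{F}\triangleright(pp')=(\hat{F}\triangleright p)p'+(\mathrm{e}^{-\hbar\hat{H}}\triangleright p)(\hat{F}\triangleright p').$$ The isomorphism $\alpha$: put $M=\frac12H$, $C=EF+FE+\frac12H^2$, $J=\frac12(\sqrt{2C+1}-1)$. Then $\alpha$ is the inverse of the algebra isomorphism $\alpha^{-1}:\mathcal{U}_\hbar(\mathrm{sl}_2)\to\mathcal{U}(\mathrm{sl}_2)[[\hbar]]$ given by $$\alpha^{-1}(\hat{E})=E\,\mathrm{e}^{\hbar(M+1)}\sqrt{\tfrac{[J+M+1][J-M]}{(J+M+1)(J-M)}},\quad \alpha^{-1}(\hat{F})=F\,\mathrm{e}^{-\hbar M}\sqrt{\tfrac{[J+M][J-M+1]}{(J+M)(J-M+1)}},\quad \alpha^{-1}(\hat{H})=H .$$ The right-hand sides are read as $\hbar$-adic series whose coefficients are polynomials in $M$ and $J$. These are symmetric under $J\mapsto -J-1$, so $J$ enters only through $C=2J(J+1)$ and the right-hand sides lie in $\mathcal{U}(\mathrm{sl}_2)[[\hbar]]$. *)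

theory Defs
  imports "HOL-Analysis.Elementary_Topology" "HOL-Library.Poly_Mapping"
    "HOL-Computational_Algebra.Computational_Algebra"
begin

section \<open>Complex algebras and their \<open>\<hbar>\<close>-adic counterparts\<close>

text \<open>Unital complex algebras, possibly noncommutative; \<open>cemb\<close> is the structure map.\<close>

class complex_alg = ring_1 +
  fixes cemb :: "complex \<Rightarrow> 'a"
  assumes cemb_add: "cemb (c + d) = cemb c + cemb d"
    and cemb_mult: "cemb (c * d) = cemb c * cemb d"
    and cemb_one: "cemb 1 = 1"
    and cemb_central: "cemb c * a = a * cemb c"
begin

lemma cemb_zero: "cemb 0 = 0"
  using cemb_add[of 0 0] by simp

lemma cemb_uminus: "cemb (- c) = - cemb c"
  using cemb_add[of c "- c"] by (simp add: cemb_zero eq_neg_iff_add_eq_0 add.commute)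

lemma cemb_sum: "cemb (sum f A) = (\<Sum>i\<in>A. cemb (f i))"
  by (induction A rule: infinite_finite_induct) (simp_all add: cemb_zero cemb_add)

end

text \<open>Unital algebras over the ring of formal power series in \<open>\<hbar>\<close>.\<close>

class hbar_alg = ring_1 +
  fixes hemb :: "complex fps \<Rightarrow> 'a"
  assumes hemb_add: "hemb (f + g) = hemb f + hemb g"
    and hemb_mult: "hemb (f * g) = hemb f * hemb g"
    and hemb_one: "hemb 1 = 1"
    and hemb_central: "hemb f * a = a * hemb f"

definition hscale :: "complex fps \<Rightarrow> 'a::hbar_alg \<Rightarrow> 'a" where
  "hscale f a = hemb f * a"

lemma module_hscale: "module (hscale :: complex fps \<Rightarrow> 'a::hbar_alg \<Rightarrow> 'a)"
  by standard (simp_all add: hscale_def hemb_add hemb_mult hemb_one algebra_simps)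

definition hbar_alg_iso :: "('a::hbar_alg \<Rightarrow> 'b::hbar_alg) \<Rightarrow> bool" where
  "hbar_alg_iso f \<longleftrightarrow> module_hom hscale hscale f \<and> f 1 = 1 \<and>
     (\<forall>a b. f (a * b) = f a * f b) \<and> bij f"

instantiation complex :: complex_alg
begin
definition cemb_complex :: "complex \<Rightarrow> complex" where "cemb_complex c = c"
instance by standard (simp_all add: cemb_complex_def)
end

instantiation poly :: ("{comm_ring_1, complex_alg}") complex_alg
begin
definition cemb_poly :: "complex \<Rightarrow> 'a poly" where "cemb_poly c = [:cemb c:]"
instance
  by standard (simp_all add: cemb_poly_def cemb_add cemb_mult cemb_one one_pCons mult.commute)
end

text \<open>For an algebra \<open>'a\<close>, the elements of \<open>'a fps\<close> are the \<open>\<hbar>\<close>-adic series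
  with coefficients in \<open>'a\<close>; the variable \<open>\<hbar>\<close> is central.\<close>

instantiation fps :: (complex_alg) hbar_alg
begin
definition hemb_fps :: "complex fps \<Rightarrow> 'a fps" where
  "hemb_fps f = Abs_fps (\<lambda>n. cemb (f $ n))"
instance
proof
  fix f g :: "complex fps" and a :: "'a fps"
  show "(hemb (f + g) :: 'a fps) = hemb f + hemb g"
    by (simp add: hemb_fps_def fps_eq_iff cemb_add)
  show "(hemb (f * g) :: 'a fps) = hemb f * hemb g"
    by (simp add: hemb_fps_def fps_eq_iff fps_mult_nth cemb_sum cemb_mult)
  show "(hemb 1 :: 'a fps) = 1"
    by (simp add: hemb_fps_def fps_eq_iff cemb_one cemb_zero)
  show "hemb f * a = a * hemb f"
  proof (rule fps_ext)
    fix n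
    have "(hemb f * a) $ n = (\<Sum>i=0..n. a $ (n - i) * cemb (f $ i))"
      by (simp add: hemb_fps_def fps_mult_nth cemb_central)
    also have "\<dots> = (\<Sum>i=0..n. a $ i * cemb (f $ (n - i)))"
      by (rule sum.reindex_bij_witness[of _ "\<lambda>i. n - i" "\<lambda>i. n - i"]) auto
    finally show "(hemb f * a) $ n = (a * hemb f) $ n"
      by (simp add: hemb_fps_def fps_mult_nth)
  qed
qed
end

text \<open>The series \<open>e\<^bsup>\<hbar>a\<^esup>\<close>.\<close>

definition hexp :: "'a::complex_alg \<Rightarrow> 'a fps" where
  "hexp a = Abs_fps (\<lambda>n. cemb (1 / fact n) * a ^ n)"

text \<open>The quantum number \<open>[a]\<close>. Numerator and denominator are both divisible by \<open>\<hbar>\<close>;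
  after cancelling it, the denominator is invertible.\<close>

definition qnum :: "'a::complex_alg \<Rightarrow> 'a fps" where
  "qnum a = fps_shift 1 (hexp a - hexp (- a)) *
     hemb (inverse (fps_shift 1 (hexp 1 - hexp (- 1))))"

definition qfact :: "nat \<Rightarrow> complex fps" where
  "qfact n = (\<Prod>i=1..n. qnum (of_nat i))"

text \<open>The Gaussian binomial coefficient to the base \<open>q\<^bsup>-2\<^esup>\<close>.\<close>

definition qbinom :: "nat \<Rightarrow> nat \<Rightarrow> complex fps" where
  "qbinom n k = hexp (of_nat k * (of_nat k - of_nat n)) * (qfact n / (qfact (n - k) * qfact k))"

definition hsqrt :: "'a::complex_alg fps \<Rightarrow> 'a fps" where
  "hsqrt f = (THE g. g * g = f \<and> (\<exists>r>0. g $ 0 = cemb (complex_of_real r)))"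


section \<open>Free algebras and quotients\<close>

datatype 'g fword = FWord (letters: "'g list")

instantiation fword :: (type) monoid_add
begin
definition zero_fword :: "'g fword" where "zero_fword = FWord []"
definition plus_fword :: "'g fword \<Rightarrow> 'g fword \<Rightarrow> 'g fword" where
  "plus_fword v w = FWord (letters v @ letters w)"
instance by standard (simp_all add: zero_fword_def plus_fword_def)
end

text \<open>The free algebra on the type \<open>'g\<close> of generators.\<close>

type_synonym 'g free = "'g fword \<Rightarrow>\<^sub>0 complex"

definition gen :: "'g \<Rightarrow> 'g free" where
  "gen g = Poly_Mapping.single (FWord [g]) 1"

lemma poly_mapping_additive_induct [case_names zero single add]:
  fixes a :: "'a \<Rightarrow>\<^sub>0 'b::comm_monoid_add"
  assumes "P 0" and single: "\<And>k b. P (Poly_Mapping.single k b)"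
    and add: "\<And>a b. P a \<Longrightarrow> P b \<Longrightarrow> P (a + b)"
  shows "P a"
proof (induction a rule: update_induct)
  case const
  show ?case using \<open>P 0\<close> .
next
  case (update a k b)
  have "Poly_Mapping.update k b a = a + Poly_Mapping.single k b"
    using update(1) by (intro poly_mapping_eqI)
      (auto simp: lookup_update lookup_add lookup_single in_keys_iff when_def)
  then show ?case
    using add[OF update.IH single[of k b]] by simp
qed

instantiation poly_mapping :: (monoid_add, complex_alg) complex_alg
begin
definition cemb_poly_mapping :: "complex \<Rightarrow> 'a \<Rightarrow>\<^sub>0 'b" where
  "cemb_poly_mapping c = Poly_Mapping.single 0 (cemb c)"
instance
proof
  fix c d :: complex and a :: "'a \<Rightarrow>\<^sub>0 'b"
  show "(cemb (c + d) :: 'a \<Rightarrow>\<^sub>0 'b) = cemb c + cemb d"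
    by (simp add: cemb_poly_mapping_def cemb_add single_add)
  show "(cemb (c * d) :: 'a \<Rightarrow>\<^sub>0 'b) = cemb c * cemb d"
    by (simp add: cemb_poly_mapping_def cemb_mult mult_single)
  show "(cemb 1 :: 'a \<Rightarrow>\<^sub>0 'b) = 1"
    by (simp add: cemb_poly_mapping_def cemb_one)
  show "cemb c * a = a * cemb c"
    by (induction a rule: poly_mapping_additive_induct)
      (simp_all add: cemb_poly_mapping_def mult_single cemb_central algebra_simps)
qed
end

text \<open>Two-sided ideals and the two-sided ideal generated by a set of relators.\<close>

definition two_sided_ideal :: "'a::ring_1 set \<Rightarrow> bool" where
  "two_sided_ideal I \<longleftrightarrow> 0 \<in> I \<and> (\<forall>a\<in>I. \<forall>b\<in>I. a + b \<in> I) \<and>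
     (\<forall>a\<in>I. \<forall>r. r * a \<in> I \<and> a * r \<in> I)"

definition ideal_gen :: "'a::ring_1 set \<Rightarrow> 'a set" where
  "ideal_gen S = \<Inter>{I. two_sided_ideal I \<and> S \<subseteq> I}"

lemma two_sided_ideal_gen: "two_sided_ideal (ideal_gen S)"
  by (auto simp: ideal_gen_def two_sided_ideal_def)

lemma ideal_gen_least: "two_sided_ideal I \<Longrightarrow> S \<subseteq> I \<Longrightarrow> ideal_gen S \<subseteq> I"
  by (auto simp: ideal_gen_def)

lemma ideal_gen_superset: "S \<subseteq> ideal_gen S"
  by (auto simp: ideal_gen_def)

text \<open>The library topology on \<open>'a fps\<close> is the \<open>\<hbar>\<close>-adic one, so \<open>closure\<close>
  is the \<open>\<hbar>\<close>-adic closure.\<close>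

lemma closure_fps_iff:
  fixes S :: "'a::ring_1 fps set"
  shows "a \<in> closure S \<longleftrightarrow> (\<forall>n. \<exists>b\<in>S. \<forall>i<n. b $ i = a $ i)"
proof
  assume a: "a \<in> closure S"
  show "\<forall>n. \<exists>b\<in>S. \<forall>i<n. b $ i = a $ i"
  proof
    fix n
    have "open {H. fps_cutoff n H = fps_cutoff n a}"
      by (rule open_fps_cutoff)
    then have "{H. fps_cutoff n H = fps_cutoff n a} \<inter> S \<noteq> {}"
      using a by (subst open_Int_closure_eq_empty[symmetric]) auto
    then show "\<exists>b\<in>S. \<forall>i<n. b $ i = a $ i"
      by (auto simp: fps_cutoff_eq_fps_cutoff_iff)
  qed
next
  assume *: "\<forall>n. \<exists>b\<in>S. \<forall>i<n. b $ i = a $ i"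
  show "a \<in> closure S"
    unfolding closure_iff_nhds_not_empty
  proof (intro allI impI notI)
    fix A U assume "U \<subseteq> A" "open U" "a \<in> U" "S \<inter> A = {}"
    then obtain n where n: "{G. fps_cutoff n G = fps_cutoff n a} \<subseteq> U"
      unfolding open_fps_iff by blast
    from * obtain b where "b \<in> S" "\<forall>i<n. b $ i = a $ i" by blast
    then have "b \<in> U" using n by (auto simp: fps_cutoff_eq_fps_cutoff_iff)
    with \<open>b \<in> S\<close> \<open>U \<subseteq> A\<close> \<open>S \<inter> A = {}\<close> show False by blast
  qed
qed

lemma two_sided_ideal_closure:
  fixes I :: "'a::ring_1 fps set"
  assumes I: "two_sided_ideal I"
  shows "two_sided_ideal (closure I)"
proof -
  have "a + b \<in> closure I" if "a \<in> closure I" "b \<in> closure I" for a b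
    unfolding closure_fps_iff
  proof
    fix n
    from that obtain c d where "c \<in> I" "d \<in> I" "\<forall>i<n. c $ i = a $ i" "\<forall>i<n. d $ i = b $ i"
      unfolding closure_fps_iff by metis
    then show "\<exists>c\<in>I. \<forall>i<n. c $ i = (a + b) $ i"
      using I by (intro bexI[of _ "c + d"]) (auto simp: two_sided_ideal_def)
  qed
  moreover have "r * a \<in> closure I \<and> a * r \<in> closure I" if a: "a \<in> closure I" for a r
    unfolding closure_fps_iff
  proof (intro conjI allI)
    fix n
    from a obtain c where c: "c \<in> I" "\<forall>i<n. c $ i = a $ i"
      unfolding closure_fps_iff by metis
    show "\<exists>b\<in>I. \<forall>i<n. b $ i = (r * a) $ i"
      using c I by (intro bexI[of _ "r * c"]) (auto simp: two_sided_ideal_def fps_mult_nth)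
    show "\<exists>b\<in>I. \<forall>i<n. b $ i = (a * r) $ i"
      using c I by (intro bexI[of _ "c * r"]) (auto simp: two_sided_ideal_def fps_mult_nth)
  qed
  moreover have "0 \<in> closure I"
    using I closure_subset[of I] by (auto simp: two_sided_ideal_def)
  ultimately show ?thesis
    by (auto simp: two_sided_ideal_def)
qed

definition cong_mod :: "'a::ring_1 set \<Rightarrow> 'a \<Rightarrow> 'a \<Rightarrow> bool" where
  "cong_mod I a b \<longleftrightarrow> a - b \<in> I"

lemma two_sided_ideal_uminus: "two_sided_ideal I \<Longrightarrow> a \<in> I \<Longrightarrow> - a \<in> I"
  unfolding two_sided_ideal_def by (metis mult_minus1)

lemma cong_mod_eqI: "two_sided_ideal I \<Longrightarrow> a = b \<Longrightarrow> cong_mod I a b"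
  by (simp add: cong_mod_def two_sided_ideal_def)

lemma equivp_cong_mod:
  assumes I: "two_sided_ideal I"
  shows "equivp (cong_mod I)"
proof (rule equivpI)
  show "reflp (cong_mod I)"
    using I by (auto simp: reflp_def cong_mod_eqI)
  show "symp (cong_mod I)"
    unfolding symp_def cong_mod_def using two_sided_ideal_uminus[OF I] by (metis minus_diff_eq)
  show "transp (cong_mod I)"
    unfolding transp_def cong_mod_def using I
    by (metis two_sided_ideal_def diff_add_cancel add_diff_eq)
qed

lemma cong_mod_add:
  assumes "two_sided_ideal I" "cong_mod I a a'" "cong_mod I b b'"
  shows "cong_mod I (a + b) (a' + b')"
  using assms unfolding cong_mod_def two_sided_ideal_def
  by (metis add_diff_add)

lemma cong_mod_uminus:
  assumes "two_sided_ideal I" "cong_mod I a a'"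
  shows "cong_mod I (- a) (- a')"
  using two_sided_ideal_uminus[OF assms(1), of "a - a'"] assms(2) unfolding cong_mod_def by simp

lemma cong_mod_diff:
  assumes "two_sided_ideal I" "cong_mod I a a'" "cong_mod I b b'"
  shows "cong_mod I (a - b) (a' - b')"
  using cong_mod_add[OF assms(1,2) cong_mod_uminus[OF assms(1,3)]] by simp

lemma cong_mod_mult:
  assumes "two_sided_ideal I" "cong_mod I a a'" "cong_mod I b b'"
  shows "cong_mod I (a * b) (a' * b')"
proof -
  have "a * b - a' * b' = a * (b - b') + (a - a') * b'"
    by (simp add: algebra_simps)
  then show ?thesis
    using assms unfolding cong_mod_def two_sided_ideal_def by metis
qed

text \<open>Nontriviality of the quotients below: the constant term is a homomorphism which kills
  all the relators.\<close>

lemma lookup_mult_zero: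
  fixes a b :: "'g free"
  shows "Poly_Mapping.lookup (a * b) 0 = Poly_Mapping.lookup a 0 * Poly_Mapping.lookup b 0"
proof (induction a rule: poly_mapping_additive_induct)
  case (single k c)
  show ?case
  proof (induction b rule: poly_mapping_additive_induct)
    case (single l d)
    have "k + l = 0 \<longleftrightarrow> k = 0 \<and> l = 0"
      by (cases k; cases l) (auto simp: zero_fword_def plus_fword_def)
    then show ?case
      by (auto simp: mult_single lookup_single when_def)
  qed (simp_all add: lookup_add algebra_simps)
qed (simp_all add: lookup_add algebra_simps)

lemma two_sided_ideal_aug: "two_sided_ideal {a :: 'g free. Poly_Mapping.lookup a 0 = 0}"
  by (auto simp: two_sided_ideal_def lookup_add lookup_mult_zero)

lemma two_sided_ideal_haug: "two_sided_ideal {a :: 'g free fps. Poly_Mapping.lookup (a $ 0) 0 = 0}"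
  by (auto simp: two_sided_ideal_def lookup_add lookup_mult_zero fps_mult_nth)

lemma closure_ideal_gen_haug:
  assumes "S \<subseteq> {a :: 'g free fps. Poly_Mapping.lookup (a $ 0) 0 = 0}" "a \<in> closure (ideal_gen S)"
  shows "Poly_Mapping.lookup (a $ 0) 0 = 0"
proof -
  from assms(2) obtain b where "b \<in> ideal_gen S" "b $ 0 = a $ 0"
    unfolding closure_fps_iff by blast
  then show ?thesis
    using ideal_gen_least[OF two_sided_ideal_haug assms(1)] by auto
qed

lemma lookup_gen_zero [simp]: "Poly_Mapping.lookup (gen g) 0 = 0"
  by (simp add: gen_def lookup_single zero_fword_def)


section \<open>The undeformed algebra and its action on polynomials\<close>

datatype sl2_gen = GenE | GenH | GenF

definition sl2_relators :: "sl2_gen free set" where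
  "sl2_relators =
    {gen GenH * gen GenE - gen GenE * gen GenH - 2 * gen GenE,
     gen GenH * gen GenF - gen GenF * gen GenH + 2 * gen GenF,
     gen GenE * gen GenF - gen GenF * gen GenE - gen GenH}"

text \<open>The universal enveloping algebra of \<open>sl\<^sub>2\<close>.\<close>

quotient_type usl2 = "sl2_gen free" / "cong_mod (ideal_gen sl2_relators)"
  by (rule equivp_cong_mod) (rule two_sided_ideal_gen)

lemma sl2_relators_aug: "a \<in> ideal_gen sl2_relators \<Longrightarrow> Poly_Mapping.lookup a 0 = 0"
  using ideal_gen_least[OF two_sided_ideal_aug, of sl2_relators]
  by (auto simp: sl2_relators_def lookup_add lookup_minus lookup_mult_zero)

instantiation usl2 :: complex_alg
begin

lift_definition zero_usl2 :: usl2 is 0 .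
lift_definition one_usl2 :: usl2 is 1 .
lift_definition plus_usl2 :: "usl2 \<Rightarrow> usl2 \<Rightarrow> usl2" is "(+)"
  by (rule cong_mod_add[OF two_sided_ideal_gen])
lift_definition minus_usl2 :: "usl2 \<Rightarrow> usl2 \<Rightarrow> usl2" is "(-)"
  by (rule cong_mod_diff[OF two_sided_ideal_gen])
lift_definition uminus_usl2 :: "usl2 \<Rightarrow> usl2" is "uminus"
  by (rule cong_mod_uminus[OF two_sided_ideal_gen])
lift_definition times_usl2 :: "usl2 \<Rightarrow> usl2 \<Rightarrow> usl2" is "(*)"
  by (rule cong_mod_mult[OF two_sided_ideal_gen])
lift_definition cemb_usl2 :: "complex \<Rightarrow> usl2" is cemb .

instance
proof
  show "(0::usl2) \<noteq> 1"
    by transfer (auto simp: cong_mod_def lookup_minus dest!: sl2_relators_aug)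
qed (transfer, rule cong_mod_eqI[OF two_sided_ideal_gen],
      (rule cemb_add cemb_mult cemb_one cemb_central | simp add: algebra_simps))+

end

definition ugen :: "sl2_gen \<Rightarrow> usl2" where "ugen g = abs_usl2 (gen g)"


text \<open>The polynomial ring in \<open>x\<close> and \<open>y\<close> is rendered as \<open>complex poly poly\<close>:
  the outer variable is \<open>y\<close>, the inner one \<open>x\<close>.\<close>

definition px :: "complex poly poly" where "px = [:[:0, 1:]:]"
definition py :: "complex poly poly" where "py = [:0, 1:]"

abbreviation dx :: "complex poly poly \<Rightarrow> complex poly poly" where "dx \<equiv> map_poly pderiv"
abbreviation dy :: "complex poly poly \<Rightarrow> complex poly poly" where "dy \<equiv> pderiv"

fun gen_act :: "sl2_gen \<Rightarrow> complex poly poly \<Rightarrow> complex poly poly" where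
  "gen_act GenE p = py * dx p"
| "gen_act GenH p = py * dy p - px * dx p"
| "gen_act GenF p = px * dy p"

definition free_act :: "sl2_gen free \<Rightarrow> complex poly poly \<Rightarrow> complex poly poly" where
  "free_act a p =
     (\<Sum>w\<in>Poly_Mapping.keys a. cemb (Poly_Mapping.lookup a w) * foldr gen_act (letters w) p)"

lemma dx_add: "dx (p + q) = dx p + dx q"
  by (intro poly_eqI) (simp add: coeff_map_poly pderiv_add)

lemma dx_diff: "dx (p - q) = dx p - dx q"
  by (intro poly_eqI) (simp add: coeff_map_poly pderiv_diff)

lemma dx_mult: "dx (p * q) = dx p * q + p * dx q"
proof (rule poly_eqI)
  fix n
  have pderiv_sum: "pderiv (sum f A) = (\<Sum>i\<in>A. pderiv (f i))" for f :: "nat \<Rightarrow> complex poly" and A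
    by (induction A rule: infinite_finite_induct) (simp_all add: pderiv_add)
  show "coeff (dx (p * q)) n = coeff (dx p * q + p * dx q) n"
    by (simp add: coeff_map_poly coeff_mult pderiv_sum pderiv_mult sum.distrib
        mult.commute[of _ "pderiv _"] add.commute)
qed

lemma dx_cemb: "dx (cemb c) = 0"
  by (intro poly_eqI) (simp add: coeff_map_poly cemb_poly_def cemb_complex_def coeff_pCons pderiv_pCons split: nat.split)

lemma dy_cemb: "dy (cemb c) = 0"
  by (simp add: cemb_poly_def pderiv_pCons)

lemma dx_dy: "dx (dy p) = dy (dx p)"
  by (intro poly_eqI)
    (simp add: coeff_map_poly coeff_pderiv pderiv_mult pderiv_of_nat del: of_nat_Suc)

lemma dx_px: "dx px = 1" and dx_py: "dx py = 0" and dy_px: "dy px = 0" and dy_py: "dy py = 1"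
  by (simp_all add: px_def py_def map_poly_pCons pderiv_pCons one_pCons)

lemma gen_act_add: "gen_act g (p + q) = gen_act g p + gen_act g q"
  by (cases g) (simp_all add: dx_add pderiv_add algebra_simps)

lemma gen_act_cemb: "gen_act g (cemb c * p) = cemb c * gen_act g p"
  by (cases g) (simp_all add: dx_mult dx_cemb dy_cemb pderiv_mult algebra_simps)

lemma word_act_add: "foldr gen_act w (p + q) = foldr gen_act w p + foldr gen_act w q"
  by (induction w) (simp_all add: gen_act_add)

lemma word_act_cemb: "foldr gen_act w (cemb c * p) = cemb c * foldr gen_act w p"
  by (induction w) (simp_all add: gen_act_cemb)

lemma free_act_zero: "free_act 0 p = 0"
  by (simp add: free_act_def)

lemma free_act_single: "free_act (Poly_Mapping.single w c) p = cemb c * foldr gen_act (letters w) p"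
  by (simp add: free_act_def cemb_zero)

lemma free_act_superset:
  assumes "finite A" "Poly_Mapping.keys a \<subseteq> A"
  shows "free_act a p = (\<Sum>w\<in>A. cemb (Poly_Mapping.lookup a w) * foldr gen_act (letters w) p)"
  unfolding free_act_def using assms
  by (intro sum.mono_neutral_left) (auto simp: in_keys_iff cemb_zero)

lemma free_act_add: "free_act (a + b) p = free_act a p + free_act b p"
proof -
  let ?A = "Poly_Mapping.keys a \<union> Poly_Mapping.keys b"
  have *: "free_act c p = (\<Sum>w\<in>?A. cemb (Poly_Mapping.lookup c w) * foldr gen_act (letters w) p)"
    if "Poly_Mapping.keys c \<subseteq> ?A" for c
    using that by (intro free_act_superset) auto
  show ?thesis
    using Poly_Mapping.keys_add[of a b]
    by (simp add: * lookup_add cemb_add algebra_simps sum.distrib)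
qed

lemma free_act_arg_add: "free_act a (p + q) = free_act a p + free_act a q"
  by (simp add: free_act_def word_act_add algebra_simps sum.distrib)

lemma free_act_arg_zero: "free_act a 0 = 0"
  using free_act_arg_add[of a 0 0] by simp

lemma free_act_mult: "free_act (a * b) p = free_act a (free_act b p)"
proof (induction a rule: poly_mapping_additive_induct)
  case (single v c)
  show ?case
  proof (induction b rule: poly_mapping_additive_induct)
    case (single w d)
    show ?case
      by (simp add: mult_single free_act_single plus_fword_def word_act_cemb cemb_mult mult.assoc)
  qed (simp_all add: free_act_zero free_act_arg_zero free_act_add free_act_arg_add distrib_left)
qed (simp_all add: free_act_zero free_act_add distrib_right)

lemma free_act_gen: "free_act (gen g) p = gen_act g p"
  by (simp add: gen_def free_act_single cemb_one)

lemma free_act_uminus: "free_act (- a) p = - free_act a p"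
  using free_act_add[of a "- a" p] by (simp add: free_act_zero eq_neg_iff_add_eq_0 add.commute)

lemma free_act_diff: "free_act (a - b) p = free_act a p - free_act b p"
  using free_act_add[of a "- b" p] by (simp add: free_act_uminus)

lemma free_act_relators:
  assumes "a \<in> ideal_gen sl2_relators"
  shows "free_act a p = 0"
proof -
  have two: "2 * a = a + a" for a :: "sl2_gen free"
    by (simp only: mult_2)
  have "two_sided_ideal {a. \<forall>p. free_act a p = 0}"
    by (auto simp: two_sided_ideal_def free_act_zero free_act_add free_act_mult free_act_arg_zero)
  moreover have "sl2_relators \<subseteq> {a. \<forall>p. free_act a p = 0}"
    by (auto simp: sl2_relators_def two free_act_add free_act_diff free_act_mult free_act_gen
        dx_mult dx_px dx_py dy_px dy_py dx_dy pderiv_mult pderiv_diff dx_add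
        dx_diff algebra_simps)
  ultimately have "ideal_gen sl2_relators \<subseteq> {a. \<forall>p. free_act a p = 0}"
    by (rule ideal_gen_least)
  with assms show ?thesis by blast
qed

text \<open>The action of the enveloping algebra on polynomials, and its \<open>\<hbar>\<close>-linear extension.\<close>

lift_definition usl2_act :: "usl2 \<Rightarrow> complex poly poly \<Rightarrow> complex poly poly" is free_act
proof
  fix a b p assume "cong_mod (ideal_gen sl2_relators) a b"
  then have "free_act (a - b) p = 0"
    unfolding cong_mod_def by (rule free_act_relators)
  then show "free_act a p = free_act b p"
    by (simp add: free_act_diff)
qed

definition rho :: "usl2 fps \<Rightarrow> complex poly poly fps \<Rightarrow> complex poly poly fps" where
  "rho u p = Abs_fps (\<lambda>n. \<Sum>i\<le>n. usl2_act (u $ i) (p $ (n - i)))"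


section \<open>The deformed algebra and the quantum plane\<close>

definition uh_relators :: "sl2_gen free fps set" where
  "uh_relators =
    {fps_const (gen GenH * gen GenE - gen GenE * gen GenH - 2 * gen GenE),
     fps_const (gen GenH * gen GenF - gen GenF * gen GenH + 2 * gen GenF),
     fps_const (gen GenE * gen GenF - gen GenF * gen GenE) - qnum (gen GenH)}"

quotient_type uh = "sl2_gen free fps" / "cong_mod (closure (ideal_gen uh_relators))"
  by (rule equivp_cong_mod) (rule two_sided_ideal_closure[OF two_sided_ideal_gen])

lemmas two_sided_ideal_uh =
  two_sided_ideal_closure[OF two_sided_ideal_gen, of uh_relators]

lemma uh_relators_aug: "a \<in> closure (ideal_gen uh_relators) \<Longrightarrow> Poly_Mapping.lookup (a $ 0) 0 = 0"
  by (erule closure_ideal_gen_haug[rotated])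
    (auto simp: uh_relators_def lookup_add lookup_minus lookup_mult_zero qnum_def hexp_def)

instantiation uh :: hbar_alg
begin

lift_definition zero_uh :: uh is 0 .
lift_definition one_uh :: uh is 1 .
lift_definition plus_uh :: "uh \<Rightarrow> uh \<Rightarrow> uh" is "(+)"
  by (rule cong_mod_add[OF two_sided_ideal_uh])
lift_definition minus_uh :: "uh \<Rightarrow> uh \<Rightarrow> uh" is "(-)"
  by (rule cong_mod_diff[OF two_sided_ideal_uh])
lift_definition uminus_uh :: "uh \<Rightarrow> uh" is "uminus"
  by (rule cong_mod_uminus[OF two_sided_ideal_uh])
lift_definition times_uh :: "uh \<Rightarrow> uh \<Rightarrow> uh" is "(*)"
  by (rule cong_mod_mult[OF two_sided_ideal_uh])
lift_definition hemb_uh :: "complex fps \<Rightarrow> uh" is hemb .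

instance
proof
  show "(0::uh) \<noteq> 1"
    by transfer (auto simp: cong_mod_def lookup_minus dest!: uh_relators_aug)
qed (transfer, rule cong_mod_eqI[OF two_sided_ideal_uh],
      (rule hemb_add hemb_mult hemb_one hemb_central | simp add: algebra_simps))+

end

definition uhgen :: "sl2_gen \<Rightarrow> uh" where "uhgen g = abs_uh (fps_const (gen g))"

datatype plane_gen = GenX | GenY

definition xh_relators :: "plane_gen free fps set" where
  "xh_relators =
    {fps_const (gen GenX * gen GenY) - hemb (hexp 1) * fps_const (gen GenY * gen GenX)}"

text \<open>The quantum plane.\<close>

quotient_type xh = "plane_gen free fps" / "cong_mod (closure (ideal_gen xh_relators))"
  by (rule equivp_cong_mod) (rule two_sided_ideal_closure[OF two_sided_ideal_gen])

lemmas two_sided_ideal_xh =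
  two_sided_ideal_closure[OF two_sided_ideal_gen, of xh_relators]

lemma xh_relators_aug: "a \<in> closure (ideal_gen xh_relators) \<Longrightarrow> Poly_Mapping.lookup (a $ 0) 0 = 0"
  by (erule closure_ideal_gen_haug[rotated])
    (auto simp: xh_relators_def lookup_minus lookup_mult_zero)

instantiation xh :: hbar_alg
begin

lift_definition zero_xh :: xh is 0 .
lift_definition one_xh :: xh is 1 .
lift_definition plus_xh :: "xh \<Rightarrow> xh \<Rightarrow> xh" is "(+)"
  by (rule cong_mod_add[OF two_sided_ideal_xh])
lift_definition minus_xh :: "xh \<Rightarrow> xh \<Rightarrow> xh" is "(-)"
  by (rule cong_mod_diff[OF two_sided_ideal_xh])
lift_definition uminus_xh :: "xh \<Rightarrow> xh" is "uminus"
  by (rule cong_mod_uminus[OF two_sided_ideal_xh])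
lift_definition times_xh :: "xh \<Rightarrow> xh \<Rightarrow> xh" is "(*)"
  by (rule cong_mod_mult[OF two_sided_ideal_xh])
lift_definition hemb_xh :: "complex fps \<Rightarrow> xh" is hemb .

instance
proof
  show "(0::xh) \<noteq> 1"
    by transfer (auto simp: cong_mod_def lookup_minus dest!: xh_relators_aug)
qed (transfer, rule cong_mod_eqI[OF two_sided_ideal_xh],
      (rule hemb_add hemb_mult hemb_one hemb_central | simp add: algebra_simps))+

end

definition xhgen :: "plane_gen \<Rightarrow> xh" where "xhgen g = abs_xh (fps_const (gen g))"


text \<open>The deformed action. The elements \<open>e\<^bsup>\<hbar>H\<^esup>\<close> and \<open>e\<^bsup>-\<hbar>H\<^esup>\<close> of the deformed
  algebra are the classes of the corresponding series in the free algebra; scalars such as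
  \<open>e\<^bsup>\<hbar>/2\<^esup>\<close> are \<open>hexp (1/2)\<close>.\<close>

definition uh_expH :: uh where "uh_expH = abs_uh (hexp (gen GenH))"
definition uh_exp_minusH :: uh where "uh_exp_minusH = abs_uh (hexp (- gen GenH))"

definition hbar_action :: "('u::hbar_alg \<Rightarrow> 'x::hbar_alg \<Rightarrow> 'x) \<Rightarrow> bool" where
  "hbar_action r \<longleftrightarrow>
     (\<forall>p. module_hom hscale hscale (\<lambda>u. r u p)) \<and> (\<forall>u. module_hom hscale hscale (r u)) \<and>
     (\<forall>p. r 1 p = p) \<and> (\<forall>u v p. r (u * v) p = r u (r v p))"

definition quantum_plane_action :: "(uh \<Rightarrow> xh \<Rightarrow> xh) \<Rightarrow> bool" where
  "quantum_plane_action r \<longleftrightarrow> hbar_action r \<and>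
     r (uhgen GenH) (xhgen GenX) = - xhgen GenX \<and>
     r (uhgen GenH) (xhgen GenY) = xhgen GenY \<and>
     r (uhgen GenE) (xhgen GenX) = hscale (hexp (1 / 2)) (xhgen GenY) \<and>
     r (uhgen GenE) (xhgen GenY) = 0 \<and>
     r (uhgen GenF) (xhgen GenY) = hscale (hexp (- 1 / 2)) (xhgen GenX) \<and>
     r (uhgen GenF) (xhgen GenX) = 0 \<and>
     (\<forall>g. r (uhgen g) 1 = 0) \<and>
     (\<forall>p p'. r (uhgen GenH) (p * p') = r (uhgen GenH) p * p' + p * r (uhgen GenH) p') \<and>
     (\<forall>p p'. r (uhgen GenE) (p * p') =
        r (uhgen GenE) p * r uh_expH p' + p * r (uhgen GenE) p') \<and>
     (\<forall>p p'. r (uhgen GenF) (p * p') =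
        r (uhgen GenF) p * p' + r uh_exp_minusH p * r (uhgen GenF) p')"


section \<open>The isomorphism of the two algebras\<close>

text \<open>Polynomials in \<open>M\<close> and \<open>J\<close> are rendered as \<open>complex poly poly\<close>: the outer variable
  is \<open>J\<close>, the inner one \<open>M\<close>.\<close>

definition pM :: "complex poly poly" where "pM = [:[:0, 1:]:]"
definition pJ :: "complex poly poly" where "pJ = [:0, 1:]"

text \<open>\<open>[a][b] / (ab)\<close>; each coefficient of \<open>[a][b]\<close> is divisible by \<open>ab\<close>, so \<open>div\<close> is
  exact here.\<close>

definition qratio :: "complex poly poly \<Rightarrow> complex poly poly \<Rightarrow> complex poly poly fps" where
  "qratio a b = Abs_fps (\<lambda>n. (qnum a * qnum b) $ n div (a * b))"

definition uM :: usl2 where "uM = cemb (1 / 2) * ugen GenH"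
definition uC :: usl2 where
  "uC = ugen GenE * ugen GenF + ugen GenF * ugen GenE + cemb (1 / 2) * ugen GenH ^ 2"

text \<open>The value at \<open>M\<close> and \<open>C\<close> of a polynomial with inner variable \<open>M\<close> and outer
  variable \<open>C\<close>.\<close>

definition eval_MC :: "complex poly poly \<Rightarrow> usl2" where
  "eval_MC t = (\<Sum>j\<le>degree t. \<Sum>i\<le>degree (coeff t j).
     cemb (coeff (coeff t j) i) * uM ^ i * uC ^ j)"

text \<open>For a polynomial \<open>s\<close> in \<open>M\<close> and \<open>J\<close> that is symmetric under \<open>J \<mapsto> -J-1\<close>:
  rewrite it as the unique polynomial in \<open>M\<close> and \<open>C = 2J(J+1)\<close> and evaluate.\<close>

definition eval_MJ :: "complex poly poly \<Rightarrow> usl2" where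
  "eval_MJ s = eval_MC (THE t. pcompose t (2 * pJ * (pJ + 1)) = s)"

definition heval_MJ :: "complex poly poly fps \<Rightarrow> usl2 fps" where
  "heval_MJ f = Abs_fps (\<lambda>n. eval_MJ (f $ n))"

definition is_alpha :: "(usl2 fps \<Rightarrow> uh) \<Rightarrow> bool" where
  "is_alpha \<alpha> \<longleftrightarrow> hbar_alg_iso \<alpha> \<and>
     inv \<alpha> (uhgen GenE) = fps_const (ugen GenE) *
       heval_MJ (hexp (pM + 1) * hsqrt (qratio (pJ + pM + 1) (pJ - pM))) \<and>
     inv \<alpha> (uhgen GenF) = fps_const (ugen GenF) *
       heval_MJ (hexp (- pM) * hsqrt (qratio (pJ + pM) (pJ - pM + 1))) \<and>
     inv \<alpha> (uhgen GenH) = fps_const (ugen GenH)"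


section \<open>The ordering prescription\<close>

definition phi_coeff :: "nat \<Rightarrow> nat \<Rightarrow> complex fps" where
  "phi_coeff k l = hsqrt (qbinom (k + l) k) *
     fps_const (complex_of_real (1 / sqrt (real ((k + l) choose k))))"

text \<open>On polynomials \<open>\<phi>\<close> is given by its values on monomials, here still with values in the
  free algebra. The value on \<open>\<Sum>\<hbar>\<^sup>np\<^sub>n\<close> is the class of the \<open>\<hbar>\<close>-adic limit
  \<open>\<Sum>\<hbar>\<^sup>n\<phi>(p\<^sub>n)\<close>.\<close>

definition phi_poly :: "complex poly poly \<Rightarrow> plane_gen free fps" where
  "phi_poly p = (\<Sum>l\<le>degree p. \<Sum>k\<le>degree (coeff p l).
     hscale (fps_const (coeff (coeff p l) k) * phi_coeff k l)
       (fps_const (gen GenX ^ k * gen GenY ^ l)))"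

definition phi :: "complex poly poly fps \<Rightarrow> xh" where
  "phi p = abs_xh (Abs_fps (\<lambda>m. \<Sum>n\<le>m. phi_poly (p $ n) $ (m - n)))"

lemma abs_xh_mult: "abs_xh (a * b) = abs_xh a * abs_xh b"
  by (simp add: times_xh.abs_eq)

lemma abs_xh_power: "abs_xh (a ^ n) = abs_xh a ^ n"
  by (induction n) (simp_all add: abs_xh_mult one_xh.abs_eq)

lemma phi_monomial:
  "phi (fps_const (px ^ k * py ^ l)) = hscale (phi_coeff k l) (xhgen GenX ^ k * xhgen GenY ^ l)"
proof -
  have m: "px ^ k * py ^ l = monom (monom 1 k) l"
    by (simp add: px_def py_def poly_const_pow monom_altdef)
  have zero: "hscale (fps_const 0 * f) a = 0" for f and a :: "plane_gen free fps"
    by (simp add: hscale_def hemb_fps_def fps_eq_iff fps_mult_nth cemb_zero)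
  let ?t = "\<lambda>k' l'. hscale (fps_const (coeff (coeff (monom (monom (1::complex) k) l) l') k') * phi_coeff k' l')
      (fps_const (gen GenX ^ k' * gen GenY ^ l')) :: plane_gen free fps"
  have "phi_poly (px ^ k * py ^ l) = (\<Sum>l'\<le>l. if l' = l then ?t k l else 0)"
    unfolding phi_poly_def m
  proof (rule sum.cong)
    fix l' assume "l' \<in> {..l}"
    show "(\<Sum>k'\<le>degree (coeff (monom (monom (1::complex) k) l) l'). ?t k' l') = (if l' = l then ?t k l else 0)"
    proof (cases "l' = l")
      case True
      have "(\<Sum>k'\<le>k. ?t k' l) = (\<Sum>k'\<le>k. if k' = k then ?t k l else 0)"
        by (rule sum.cong) (auto simp: zero simp del: fps_const_0_eq_0)
      then show ?thesis
        using True by (simp add: degree_monom_eq)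
    next
      case False
      then show ?thesis by (simp add: zero del: fps_const_0_eq_0)
    qed
  qed (simp add: degree_monom_eq)
  then have poly: "phi_poly (px ^ k * py ^ l) =
      hscale (phi_coeff k l) (fps_const (gen GenX ^ k * gen GenY ^ l))"
    by simp
  have "phi_poly 0 = 0"
    unfolding phi_poly_def using zero by (simp del: fps_const_0_eq_0)
  then have const: "phi (fps_const q) = abs_xh (phi_poly q)" for q
  proof -
    have "(\<Sum>n\<le>m. phi_poly (fps_const q $ n) $ (m - n)) =
        (\<Sum>n\<le>m. if n = 0 then phi_poly q $ m else 0)" for m
      using \<open>phi_poly 0 = 0\<close> by (intro sum.cong) auto
    then show ?thesis
      by (simp add: phi_def fps_nth_inverse)
  qed
  show ?thesis
    unfolding const poly hscale_def
    by (simp add: abs_xh_mult hemb_xh.abs_eq xhgen_def fps_const_power flip: abs_xh_power fps_const_mult)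
qed

end

theory Submission
  imports Defs
begin

text \<open>The polynomial \<open>x\<^sup>ky\<^sup>l\<close> is a weight vector on which \<open>M\<close> and \<open>C\<close> act by scalars; those
  are the values at \<open>M = (l - k)/2\<close>, \<open>J = (k + l)/2\<close>, so that \<open>J + M = l\<close> and \<open>J - M = k\<close>.
  Hence \<open>\<alpha>\<^bsup>-1\<^esup>\<close> of a deformed generator acts on \<open>x\<^sup>ky\<^sup>l\<close> like the undeformed generator, up
  to an explicit scalar series. On the other side, the twisted Leibniz rules move \<open>x\<^sup>ky\<^sup>l\<close>,
  read in the quantum plane, to a multiple of a neighbouring ordered monomial, with a
  quantum number as coefficient. The map \<open>\<phi>\<close> only rescales ordered monomials, say by
  \<open>c(k,l)\<close>. So for each generator equivariance on \<open>x\<^sup>ky\<^sup>l\<close> is one identity between scalar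
  series. For \<open>E\<close> and \<open>F\<close> the squares of the two sides agree because of the recursion
  \<open>c(k,l+1)\<^sup>2 [l+1]/(l+1) = e\<^bsup>\<hbar>(l-k)\<^esup> c(k+1,l)\<^sup>2 [k+1]/(k+1)\<close> (lemma \<open>phi_coeff_ratio\<close>),
  which comes from the definition of \<open>c(k,l)\<close> as a square root of a ratio of two binomial
  coefficients; the two sides themselves then agree because both have positive constant
  terms (\<open>match_square_roots\<close>).

  From generators and monomials the identity spreads to all elements by
  \<open>hbar_additive_eqI\<close>: linear maps over the ring of power series which agree on coefficients
  agree modulo every power of \<open>\<hbar>\<close>, and this determines their values because the quantum
  plane is \<open>\<hbar>\<close>-adically separated.

  For bijectivity of \<open>\<phi>\<close>, the relation lets every word in \<open>x\<close> and \<open>y\<close> be ordered at the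
  cost of a power of \<open>e\<^bsup>-\<hbar>\<^esup>\<close>, which gives surjectivity. Conversely, weighting a word with as
  many factors \<open>e\<^bsup>-\<hbar>\<^esup>\<close> as it has inversions gives functionals on the free algebra which
  vanish on the closed ideal of relations and read off the coefficients of \<open>\<phi>(p)\<close> (lemmas
  \<open>coordinate_eq_0\<close> and \<open>coordinate_phi\<close>).\<close>

section \<open>Additive maps commuting with \<open>\<hbar>\<close>\<close>

class sep_hbar_alg = hbar_alg +
  assumes hbar_separated: "(\<And>n. \<exists>b. a = hemb fps_X ^ n * b) \<Longrightarrow> a = 0"

text \<open>Linearity over the power series is awkward to check coefficientwise, since it involves
  a convolution; additivity and compatibility with \<open>\<hbar>\<close> are easy, and imply it for maps which
  are \<open>\<complex>\<close>-linear on constants (\<open>hbar_additive_imp_module_hom\<close>).\<close>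

definition hbar_additive :: "('a::hbar_alg \<Rightarrow> 'b::hbar_alg) \<Rightarrow> bool" where
  "hbar_additive f \<longleftrightarrow>
     (\<forall>a b. f (a + b) = f a + f b) \<and> (\<forall>a. f (hemb fps_X * a) = hemb fps_X * f a)"

lemma hemb_zero [simp]: "hemb 0 = (0 :: 'a::hbar_alg)"
  using hemb_add[of 0 0, where 'a='a] by simp

lemma hemb_complex [simp]: "(hemb f :: complex fps) = f"
  by (simp add: hemb_fps_def cemb_complex_def fps_eq_iff)

lemma hemb_fps_X [simp]: "(hemb fps_X :: 'a::complex_alg fps) = fps_X"
  by (simp add: hemb_fps_def fps_eq_iff cemb_zero cemb_one)

lemma hemb_fps_const [simp]: "(hemb (fps_const c) :: 'a::complex_alg fps) = fps_const (cemb c)"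
  by (simp add: hemb_fps_def fps_eq_iff cemb_zero)

lemma hemb_nth [simp]: "(hemb f :: 'a::complex_alg fps) $ n = cemb (f $ n)"
  by (simp add: hemb_fps_def)

lemma fps_eq_const_plus_X_shift: "(a :: 'a::ring_1 fps) = fps_const (a $ 0) + fps_X * fps_shift 1 a"
proof (rule fps_ext)
  fix n show "a $ n = (fps_const (a $ 0) + fps_X * fps_shift 1 a) $ n"
    by (cases n) auto
qed

lemma hbar_additiveI:
  assumes "\<And>a b. f (a + b) = f a + f b" "\<And>a. f (hemb fps_X * a) = hemb fps_X * f a"
  shows "hbar_additive f"
  using assms by (auto simp: hbar_additive_def)

lemma hbar_additive_add: "hbar_additive f \<Longrightarrow> f (a + b) = f a + f b"
  by (simp add: hbar_additive_def)

lemma hbar_additive_hbar: "hbar_additive f \<Longrightarrow> f (hemb fps_X * a) = hemb fps_X * f a"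
  by (simp add: hbar_additive_def)

lemma hbar_additive_compose: "hbar_additive f \<Longrightarrow> hbar_additive g \<Longrightarrow> hbar_additive (\<lambda>x. f (g x))"
  by (auto simp: hbar_additive_def)

lemma hbar_additive_mult_left: "hbar_additive (\<lambda>x. c * (x :: 'a::hbar_alg))"
proof (rule hbar_additiveI)
  fix a :: 'a
  have "c * (hemb fps_X * a) = (c * hemb fps_X) * a"
    by (simp add: mult.assoc)
  also have "\<dots> = hemb fps_X * (c * a)"
    by (simp add: mult.assoc flip: hemb_central)
  finally show "c * (hemb fps_X * a) = hemb fps_X * (c * a)" .
qed (simp add: distrib_left)

lemma hbar_additive_mult_right: "hbar_additive (\<lambda>x. (x :: 'a::hbar_alg) * c)"
  by (rule hbar_additiveI) (simp_all add: algebra_simps)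

lemma hbar_additive_hemb: "hbar_additive (hemb :: complex fps \<Rightarrow> 'a::hbar_alg)"
  by (rule hbar_additiveI) (simp_all add: hemb_add hemb_mult)

lemma hbar_additive_module_hom:
  "module_hom hscale hscale f \<Longrightarrow> hbar_additive f"
  by (auto simp: hbar_additive_def module_hom_iff hscale_def)

text \<open>Splitting off the constant terms, \<open>f a - g b\<close> equals \<open>\<hbar>\<close> times the same expression for
  the shifted series, hence is divisible by every power of \<open>\<hbar>\<close>. With \<open>b = a\<close> this says that
  an \<open>\<hbar>\<close>-compatible additive map is determined by its values on constant series; two
  different series are needed for the action of an exponential on an eigenvector.\<close>

lemma hbar_additive_eqI:
  fixes f :: "'a::complex_alg fps \<Rightarrow> 'm::sep_hbar_alg" and g :: "'b::complex_alg fps \<Rightarrow> 'm"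
  assumes f: "hbar_additive f" and g: "hbar_additive g"
    and eq: "\<And>i. f (fps_const (a $ i)) = g (fps_const (b $ i))"
  shows "f a = g b"
proof -
  have "\<exists>c. f a - g b = hemb fps_X ^ n * c" for n
    using eq
  proof (induction n arbitrary: a b)
    case (Suc n)
    have "\<exists>c. f (fps_shift 1 a) - g (fps_shift 1 b) = hemb fps_X ^ n * c"
      by (rule Suc.IH) (simp add: Suc.prems)
    then obtain c where c: "f (fps_shift 1 a) - g (fps_shift 1 b) = hemb fps_X ^ n * c" ..
    have "f a = f (fps_const (a $ 0) + hemb fps_X * fps_shift 1 a)"
      by (subst fps_eq_const_plus_X_shift[of a]) simp
    moreover have "g b = g (fps_const (b $ 0) + hemb fps_X * fps_shift 1 b)"
      by (subst fps_eq_const_plus_X_shift[of b]) simp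
    ultimately have "f a - g b = hemb fps_X * (f (fps_shift 1 a) - g (fps_shift 1 b))"
      using Suc.prems[of 0]
      by (simp add: hbar_additive_add[OF f] hbar_additive_add[OF g] hbar_additive_hbar[OF f]
          hbar_additive_hbar[OF g] right_diff_distrib del: hemb_fps_X)
    then show ?case
      unfolding c by (metis mult.assoc power_Suc)
  qed simp
  then have "f a - g b = 0"
    by (rule hbar_separated)
  then show ?thesis by simp
qed

instance fps :: (complex_alg) sep_hbar_alg
proof
  fix a :: "'a fps"
  assume *: "\<And>n. \<exists>b. a = hemb fps_X ^ n * b"
  show "a = 0"
  proof (rule fps_ext)
    fix n
    obtain b where "a = hemb fps_X ^ Suc n * b" using * by blast
    then show "a $ n = 0 $ n" by (simp only: hemb_fps_X fps_X_power_mult_nth) simp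
  qed
qed

text \<open>Linearity is an equation of two additive \<open>\<hbar>\<close>-compatible maps in the argument and, once
  the argument is fixed, in the scalar; so \<open>hbar_additive_eqI\<close> reduces both to constants.\<close>

lemma hbar_additive_imp_module_hom:
  fixes f :: "'a::complex_alg fps \<Rightarrow> 'm::sep_hbar_alg"
  assumes f: "hbar_additive f"
    and cemb: "\<And>c a. f (fps_const (cemb c * a)) = hemb (fps_const c) * f (fps_const a)"
  shows "module_hom hscale hscale f"
proof -
  have const: "f (hemb (fps_const c) * fps_const a) = hemb (fps_const c) * f (fps_const a)" for c a
    using cemb by simp
  have "f (hemb (fps_const c) * a) = hemb (fps_const c) * f a" for c a
    by (rule hbar_additive_eqI[where a=a and b=a])
      (intro hbar_additive_compose[OF f] hbar_additive_compose[OF hbar_additive_mult_left]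
        hbar_additive_mult_left f const)+
  then have "f (hemb s * a) = hemb s * f a" for s a
    by (intro hbar_additive_eqI[where a=s and b=s and f="\<lambda>s. f (hemb s * a)"])
      (intro hbar_additive_compose[OF f] hbar_additive_compose[OF hbar_additive_mult_right]
        hbar_additive_mult_right hbar_additive_hemb f)+
  then show ?thesis
    by (simp add: module_hom_iff module_hscale hscale_def hbar_additive_add[OF f])
qed

text \<open>The \<open>\<hbar>\<close>-adic limit of \<open>\<Sum>\<hbar>\<^sup>nT(a\<^sub>n)\<close>.\<close>

definition hextend :: "('a::complex_alg \<Rightarrow> 'b::complex_alg fps) \<Rightarrow> 'a fps \<Rightarrow> 'b fps" where
  "hextend T a = Abs_fps (\<lambda>m. \<Sum>n\<le>m. T (a $ n) $ (m - n))"

lemma hextend_additive: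
  assumes add: "\<And>a b. T (a + b) = T a + T b"
  shows "hbar_additive (hextend T)"
proof (rule hbar_additiveI)
  have [simp]: "T 0 = 0" using add[of 0 0] by simp
  fix a
  show "hextend T (hemb fps_X * a) = hemb fps_X * hextend T a"
  proof (rule fps_ext)
    fix m
    show "hextend T (hemb fps_X * a) $ m = (hemb fps_X * hextend T a) $ m"
      by (cases m) (simp_all add: hextend_def sum.atMost_Suc_shift del: sum.atMost_Suc)
  qed
qed (simp add: hextend_def fps_eq_iff add sum.distrib)

lemma hextend_const:
  assumes "T 0 = 0"
  shows "hextend T (fps_const a) = T a"
proof (rule fps_ext)
  fix m
  have "(\<Sum>n\<le>m. T (fps_const a $ n) $ (m - n)) = (\<Sum>n\<le>m. if n = 0 then T a $ m else 0)"
    using assms by (intro sum.cong) auto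
  then show "hextend T (fps_const a) $ m = T a $ m" by (simp add: hextend_def)
qed

lemma hextend_module_hom:
  fixes T :: "'a::complex_alg \<Rightarrow> 'b::complex_alg fps"
  assumes add: "\<And>a b. T (a + b) = T a + T b"
    and cemb: "\<And>c a. T (cemb c * a) = fps_const (cemb c) * T a"
  shows "module_hom hscale hscale (hextend T)"
proof -
  have "T 0 = 0" using add[of 0 0] by simp
  then show ?thesis
    by (intro hbar_additive_imp_module_hom hextend_additive add) (simp add: hextend_const cemb)
qed

section \<open>Linear maps determined on monomials and words\<close>

lemma hscale_fps_const [simp]:
  "hscale (fps_const c) (fps_const a) = fps_const (cemb c * a :: 'a::complex_alg)"
  by (simp add: hscale_def)

lemma module_hom_hscale:
  "module_hom hscale hscale f \<Longrightarrow> f (hscale s a) = hscale s (f a)"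
  by (simp add: module_hom_iff)

lemma module_hom_add: "module_hom hscale hscale f \<Longrightarrow> f (a + b) = f a + f b"
  by (simp add: module_hom_iff)

lemma hscale_hscale: "hscale s (hscale t a) = hscale (s * t) a"
  by (simp add: hscale_def hemb_mult mult.assoc)

lemma module_hom_hscaleI:
  "(\<And>a b. f (a + b) = f a + f b) \<Longrightarrow> (\<And>s a. f (hscale s a) = hscale s (f a)) \<Longrightarrow>
     module_hom hscale hscale f"
  by (simp add: module_hom_iff module_hscale)

lemma module_hom_hscale_compose:
  "module_hom hscale hscale f \<Longrightarrow> module_hom hscale hscale g \<Longrightarrow>
     module_hom hscale hscale (\<lambda>x. f (g x))"
  by (simp add: module_hom_iff module_hscale)

lemma module_hom_hscale_fixed: "module_hom hscale hscale (hscale s)"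
  by (rule module_hom_hscaleI)
    (simp_all add: hscale_def algebra_simps hemb_add mult.commute flip: hemb_mult mult.assoc)

lemma closed_under_sum:
  assumes "P 0" "\<And>a b. P a \<Longrightarrow> P b \<Longrightarrow> P (a + b)" "\<And>i. i \<in> A \<Longrightarrow> P (f i)"
  shows "P (sum f A :: 'a::comm_monoid_add)"
  using assms(3) by (induction A rule: infinite_finite_induct) (auto simp: assms(1,2))

lemma cemb_monomial: "cemb c * (px ^ k * py ^ l) = monom (monom c k) l"
proof -
  have "px ^ k * py ^ l = monom (monom 1 k) l"
    by (simp add: px_def py_def poly_const_pow monom_altdef)
  then show ?thesis
    by (simp add: cemb_poly_def cemb_complex_def smult_monom)
qed

text \<open>The scalar is part of the monomial case because the zero polynomial is reached as
  \<open>c = 0\<close>.\<close>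

lemma xy_induct [case_names add monomial]:
  assumes add: "\<And>p q. P p \<Longrightarrow> P q \<Longrightarrow> P (p + q)"
    and monomial: "\<And>c k l. P (cemb c * (px ^ k * py ^ l))"
  shows "P p"
proof -
  have P0: "P 0"
    using monomial[of 0] by (simp add: cemb_zero)
  have inner: "P (monom c l)" for c l
  proof -
    have sum: "monom (\<Sum>k\<in>K. f k) l = (\<Sum>k\<in>K. monom (f k) l)" for K and f :: "nat \<Rightarrow> complex poly"
      by (induction K rule: infinite_finite_induct) (simp_all flip: add_monom)
    have "P (\<Sum>k\<le>degree c. monom (monom (coeff c k) k) l)"
      by (rule closed_under_sum) (auto simp: P0 add monomial simp flip: cemb_monomial)
    then show ?thesis
      unfolding sum[symmetric] by (simp add: poly_as_sum_of_monoms)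
  qed
  have "P (\<Sum>l\<le>degree p. monom (coeff p l) l)"
    by (rule closed_under_sum) (auto simp: P0 add inner)
  then show ?thesis
    by (simp add: poly_as_sum_of_monoms)
qed

lemma module_hom_xy_eqI:
  fixes f g :: "complex poly poly fps \<Rightarrow> 'm::sep_hbar_alg"
  assumes f: "module_hom hscale hscale f" and g: "module_hom hscale hscale g"
    and eq: "\<And>k l. f (fps_const (px ^ k * py ^ l)) = g (fps_const (px ^ k * py ^ l))"
  shows "f p = g p"
proof (rule hbar_additive_eqI[OF hbar_additive_module_hom[OF f] hbar_additive_module_hom[OF g]])
  have "f (fps_const q) = g (fps_const q)" for q
  proof (induction q rule: xy_induct)
    case (add p q)
    then show ?case
      using module_hom_add[OF f, of "fps_const p"] module_hom_add[OF g, of "fps_const p"]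
          by (simp flip: fps_const_add)
  next
    case (monomial c k l)
    show ?case
      using eq[of k l] module_hom_hscale[OF f, of "fps_const c" "fps_const (px ^ k * py ^ l)"]
        module_hom_hscale[OF g, of "fps_const c" "fps_const (px ^ k * py ^ l)"]
      by (simp del: fps_const_mult)
  qed
  then show "f (fps_const (p $ i)) = g (fps_const (p $ i))" for i .
qed

lemma free_word_induct [case_names add word]:
  fixes a :: "'g free"
  assumes add: "\<And>a b. P a \<Longrightarrow> P b \<Longrightarrow> P (a + b)"
    and word: "\<And>c w. P (cemb c * Poly_Mapping.single (FWord w) 1)"
  shows "P a"
proof (induction a rule: poly_mapping_additive_induct)
  case zero
  show ?case using word[of 0] by (simp add: cemb_zero)
next
  case (single k b)
  show ?case
    using word[of b "letters k"] by (simp add: cemb_poly_mapping_def mult_single cemb_complex_def)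
qed (rule add)

lemma module_hom_words_eqI:
  fixes f g :: "'g free fps \<Rightarrow> 'm::sep_hbar_alg"
  assumes f: "module_hom hscale hscale f" and g: "module_hom hscale hscale g"
    and eq: "\<And>w. f (fps_const (Poly_Mapping.single (FWord w) 1)) =
        g (fps_const (Poly_Mapping.single (FWord w) 1))"
  shows "f a = g a"
proof (rule hbar_additive_eqI[OF hbar_additive_module_hom[OF f] hbar_additive_module_hom[OF g]])
  have "f (fps_const b) = g (fps_const b)" for b
  proof (induction b rule: free_word_induct)
    case (add a b)
    then show ?case
      using module_hom_add[OF f, of "fps_const a"] module_hom_add[OF g, of "fps_const a"]
          by (simp flip: fps_const_add)
  next
    case (word c w)
    show ?case
      using eq[of w] module_hom_hscale[OF f, of "fps_const c"
          "fps_const (Poly_Mapping.single (FWord w) 1)"]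
        module_hom_hscale[OF g, of "fps_const c" "fps_const (Poly_Mapping.single (FWord w) 1)"]
      by (simp del: fps_const_mult)
  qed
  then show "f (fps_const (a $ i)) = g (fps_const (a $ i))" for i .
qed

lemma single_Cons: "Poly_Mapping.single (FWord (g # w)) 1 = gen g * Poly_Mapping.single (FWord w) 1"
  by (simp add: gen_def mult_single plus_fword_def)

lemma single_Nil: "Poly_Mapping.single (FWord []) 1 = 1"
  by (simp flip: zero_fword_def)

section \<open>The quotient maps and separatedness of the quantum plane\<close>

lemma abs_xh_eq_iff: "abs_xh a = abs_xh b \<longleftrightarrow> a - b \<in> closure (ideal_gen xh_relators)"
  by (simp add: xh.abs_eq_iff cong_mod_def)

lemma abs_xh_eq_0_iff: "abs_xh a = 0 \<longleftrightarrow> a \<in> closure (ideal_gen xh_relators)"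
  using abs_xh_eq_iff[of a 0] by (simp add: zero_xh.abs_eq)

lemma module_hom_abs_xh: "module_hom hscale hscale abs_xh"
  by (rule module_hom_hscaleI) (simp_all add: hscale_def plus_xh.abs_eq abs_xh_mult hemb_xh.abs_eq)

lemma module_hom_abs_uh: "module_hom hscale hscale abs_uh"
  by (rule module_hom_hscaleI)
    (simp_all add: hscale_def plus_uh.abs_eq times_uh.abs_eq hemb_uh.abs_eq)

text \<open>This is where the closure in the definition of the quantum plane enters: a class
  divisible by every power of \<open>\<hbar>\<close> is represented by a series that the ideal approximates to
  every order.\<close>

instance xh :: sep_hbar_alg
proof
  fix a :: xh
  assume *: "\<And>n. \<exists>b. a = hemb fps_X ^ n * b"
  obtain A where A: "a = abs_xh A" by (metis Quotient3_abs_rep Quotient3_xh)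
  have "A \<in> closure (ideal_gen xh_relators)"
    unfolding closure_fps_iff
  proof
    fix n
    obtain b where b: "a = hemb fps_X ^ n * b" using * by blast
    obtain B where B: "b = abs_xh B" by (metis Quotient3_abs_rep Quotient3_xh)
    have "abs_xh A = abs_xh (fps_X ^ n * B)"
      using b A B by (simp add: abs_xh_mult abs_xh_power hemb_xh.abs_eq)
    then have "A - fps_X ^ n * B \<in> closure (ideal_gen xh_relators)"
      by (simp add: abs_xh_eq_iff)
    then obtain C where "C \<in> ideal_gen xh_relators" "\<forall>i<n. C $ i = (A - fps_X ^ n * B) $ i"
      unfolding closure_fps_iff by blast
    then show "\<exists>b\<in>ideal_gen xh_relators. \<forall>i<n. b $ i = A $ i"
      by (auto simp: fps_X_power_mult_nth)
  qed
  then show "a = 0" by (simp add: A abs_xh_eq_0_iff)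
qed

lemma xhgen_commute: "xhgen GenX * xhgen GenY = hscale (hexp 1) (xhgen GenY * xhgen GenX)"
proof -
  have "fps_const (gen GenX * gen GenY) - hemb (hexp 1) * fps_const (gen GenY * gen GenX)
      \<in> closure (ideal_gen xh_relators)"
    using closure_subset ideal_gen_superset[of xh_relators] by (auto simp: xh_relators_def)
  then show ?thesis
    by (simp add: xhgen_def hscale_def hemb_xh.abs_eq flip: abs_xh_mult abs_xh_eq_iff)
qed

section \<open>Square roots and quantum numbers as series\<close>

lemma cemb_eq_0_iff [simp]: "cemb c = (0 :: 'a::complex_alg) \<longleftrightarrow> c = 0"
proof
  assume c: "cemb c = (0 :: 'a)"
  show "c = 0"
  proof (rule ccontr)
    assume "c \<noteq> 0"
    then have "(1 :: 'a) = cemb c * cemb (1 / c)"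
      by (simp add: cemb_one flip: cemb_mult)
    with c show False by simp
  qed
qed (simp add: cemb_zero)

text \<open>\<open>(g + h)(g - h) = 0\<close> in a domain, and the constant term of \<open>g + h\<close> is positive.\<close>

lemma positive_root_unique:
  fixes g h :: "'a::{idom, complex_alg} fps"
  assumes "g * g = h * h"
    and "r > 0" "g $ 0 = cemb (complex_of_real r)"
    and "s > 0" "h $ 0 = cemb (complex_of_real s)"
  shows "g = h"
proof -
  have "(g + h) * (g - h) = 0"
    using assms(1) square_diff_square_factored[of g h] by simp
  moreover have "g + h \<noteq> 0"
  proof
    assume "g + h = 0"
    then have "(g + h) $ 0 = 0" by simp
    then have "cemb (complex_of_real (r + s)) = (0 :: 'a)"
      by (simp add: assms cemb_add)
    then have "complex_of_real (r + s) = 0"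
      by (simp only: cemb_eq_0_iff)
    then show False
      using assms(2,4) by (simp only: of_real_eq_0_iff)
  qed
  ultimately have "g - h = 0"
    using mult_eq_0_iff by blast
  then show ?thesis by (rule eq_iff_diff_eq_0[THEN iffD2])
qed

lemma hsqrt_eqI:
  fixes g :: "'a::{idom, complex_alg} fps"
  assumes "g * g = f" "r > 0" "g $ 0 = cemb (complex_of_real r)"
  shows "hsqrt f = g"
  unfolding hsqrt_def
proof (rule the_equality)
  show "g * g = f \<and> (\<exists>r>0. g $ 0 = cemb (complex_of_real r))" using assms by blast
  show "h = g" if "h * h = f \<and> (\<exists>r>0. h $ 0 = cemb (complex_of_real r))" for h
    using that assms positive_root_unique[of h g] by metis
qed

text \<open>After dividing by the constant term, the root is the binomial series for the exponent
  \<open>1/2\<close>, composed with a series without constant term.\<close>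

lemma positive_root_exists:
  fixes f :: "'a::{idom, complex_alg} fps"
  assumes r: "r > 0" and f: "f $ 0 = cemb (complex_of_real r)"
  shows "\<exists>g. g * g = f \<and> g $ 0 = cemb (complex_of_real (sqrt r))"
proof -
  have const: "fps_const (cemb c) * fps_const (cemb d) = (fps_const (cemb (c * d)) :: 'a fps)"
      for c d
    by (simp add: cemb_mult)
  define u where "u = fps_const (cemb (complex_of_real (1 / r))) * f - 1"
  define b :: "'a fps" where "b = hemb (fps_binomial (1 / 2))"
  have u0: "u $ 0 = 0"
    using r by (simp add: u_def f cemb_one flip: cemb_mult of_real_mult)
  have "b * b = 1 + fps_X"
    by (simp add: b_def hemb_add hemb_one fps_binomial_1 flip: hemb_mult fps_binomial_add_mult)
  then have "(b oo u) * (b oo u) = 1 + u"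
    using u0 by (simp add: fps_compose_add_distrib flip: fps_compose_mult_distrib[OF u0])
  moreover have "(b oo u) $ 0 = 1"
    by (simp add: b_def cemb_one)
  moreover have "fps_const (cemb (complex_of_real r)) * (1 + u) = f"
  proof -
    have "1 + u = fps_const (cemb (complex_of_real (1 / r))) * f" by (simp add: u_def)
    then show ?thesis
      using r by (simp only: const mult.assoc[symmetric]) (simp add: cemb_one flip: of_real_mult)
  qed
  moreover have "fps_const (cemb (complex_of_real (sqrt r))) *
      fps_const (cemb (complex_of_real (sqrt r))) =
      (fps_const (cemb (complex_of_real r)) :: 'a fps)"
    using r by (simp only: const) (simp flip: of_real_mult)
  ultimately have "(fps_const (cemb (complex_of_real (sqrt r))) * (b oo u)) *
      (fps_const (cemb (complex_of_real (sqrt r))) * (b oo u)) = f"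
    by (metis mult.assoc mult.left_commute)
  moreover have "(fps_const (cemb (complex_of_real (sqrt r))) * (b oo u)) $ 0 =
      cemb (complex_of_real (sqrt r))"
    using \<open>(b oo u) $ 0 = 1\<close> by simp
  ultimately show ?thesis by blast
qed

lemma
  fixes f :: "'a::{idom, complex_alg} fps"
  assumes r: "r > 0" and f: "f $ 0 = cemb (complex_of_real r)"
  shows hsqrt_mult_self: "hsqrt f * hsqrt f = f"
    and hsqrt_nth_0: "hsqrt f $ 0 = cemb (complex_of_real (sqrt r))"
proof -
  obtain g where g: "g * g = f" "g $ 0 = cemb (complex_of_real (sqrt r))"
    using positive_root_exists[OF r f] by blast
  moreover from this have "hsqrt f = g"
    using r by (intro hsqrt_eqI[of g _ "sqrt r"]) auto
  ultimately show "hsqrt f * hsqrt f = f" "hsqrt f $ 0 = cemb (complex_of_real (sqrt r))" by auto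
qed

definition fps_map :: "('a::complex_alg \<Rightarrow> 'b::complex_alg) \<Rightarrow> 'a fps \<Rightarrow> 'b fps" where
  "fps_map h f = Abs_fps (\<lambda>n. h (f $ n))"

lemma fps_map_nth [simp]: "fps_map h f $ n = h (f $ n)"
  by (simp add: fps_map_def)

definition complex_alg_hom :: "('a::complex_alg \<Rightarrow> 'b::complex_alg) \<Rightarrow> bool" where
  "complex_alg_hom h \<longleftrightarrow> (\<forall>a b. h (a + b) = h a + h b) \<and> (\<forall>a b. h (a * b) = h a * h b) \<and>
     (\<forall>c. h (cemb c) = cemb c)"

context
  fixes h :: "'a::complex_alg \<Rightarrow> 'b::complex_alg"
  assumes h: "complex_alg_hom h"
begin

lemma complex_alg_hom_simps:
  "h (a + b) = h a + h b" "h (a * b) = h a * h b" "h (cemb c) = cemb c" "h 0 = 0" "h 1 = 1"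
proof -
  show *: "h (a + b) = h a + h b" "h (a * b) = h a * h b" "h (cemb c) = cemb c" for a b c
    using h by (auto simp: complex_alg_hom_def)
  show "h 0 = 0" "h 1 = 1"
    using *(3)[of 0] *(3)[of 1] by (simp_all add: cemb_zero cemb_one)
qed

lemma complex_alg_hom_power: "h (a ^ n) = h a ^ n"
  by (induction n) (simp_all add: complex_alg_hom_simps)

lemma complex_alg_hom_sum: "h (sum f A) = (\<Sum>i\<in>A. h (f i))"
  by (induction A rule: infinite_finite_induct) (simp_all add: complex_alg_hom_simps)

lemma fps_map_mult: "fps_map h (f * g) = fps_map h f * fps_map h g"
  by (simp add: fps_eq_iff fps_mult_nth complex_alg_hom_simps complex_alg_hom_sum)

lemma fps_map_hemb: "fps_map h (hemb f) = hemb f"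
  by (simp add: fps_eq_iff complex_alg_hom_simps)

lemma fps_map_hexp: "fps_map h (hexp a) = hexp (h a)"
  by (simp add: fps_eq_iff hexp_def complex_alg_hom_simps complex_alg_hom_power)

end

lemma fps_map_hsqrt:
  fixes h :: "'a::{idom, complex_alg} \<Rightarrow> 'b::{idom, complex_alg}"
  assumes h: "complex_alg_hom h" and r: "r > 0" and f: "f $ 0 = cemb (complex_of_real r)"
  shows "fps_map h (hsqrt f) = hsqrt (fps_map h f)"
proof (rule hsqrt_eqI[symmetric])
  show "fps_map h (hsqrt f) * fps_map h (hsqrt f) = fps_map h f"
    by (simp add: hsqrt_mult_self[OF r f] flip: fps_map_mult[OF h])
  show "fps_map h (hsqrt f) $ 0 = cemb (complex_of_real (sqrt r))"
    by (simp add: hsqrt_nth_0[OF r f] complex_alg_hom_simps[OF h])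
  show "sqrt r > 0" using r by simp
qed

text \<open>The series \<open>[a]/a\<close>, written without division. It is even in \<open>a\<close>, has constant term \<open>1\<close>
  and makes sense in any algebra, so it commutes with all substitutions for \<open>a\<close>, including
  those with \<open>a = 0\<close>.\<close>

definition qnum_quotient :: "'a::complex_alg \<Rightarrow> 'a fps" where
  "qnum_quotient a = Abs_fps (\<lambda>n. cemb ((1 + (- 1) ^ n) / fact (Suc n)) * a ^ n) *
     hemb (inverse (fps_shift 1 (hexp 1 - hexp (- 1))))"

lemma qnum_eq: "qnum a = fps_const a * qnum_quotient a"
proof -
  have "fps_shift 1 (hexp a - hexp (- a)) =
      fps_const a * Abs_fps (\<lambda>n. cemb ((1 + (- 1) ^ n) / fact (Suc n)) * a ^ n)"
  proof (rule fps_ext)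
    fix n
    have comm: "a * (cemb c * a ^ n) = cemb c * a ^ Suc n" for c
      by (metis cemb_central mult.assoc power_Suc)
    show "fps_shift 1 (hexp a - hexp (- a)) $ n =
      (fps_const a * Abs_fps (\<lambda>n. cemb ((1 + (- 1) ^ n) / fact (Suc n)) * a ^ n)) $ n"
    proof (cases "even n")
      case True
      then have "fps_shift 1 (hexp a - hexp (- a)) $ n =
          cemb (1 / fact (Suc n)) * a ^ Suc n + cemb (1 / fact (Suc n)) * a ^ Suc n"
        by (simp add: hexp_def del: fact_Suc)
      also have "\<dots> = cemb (2 / fact (Suc n)) * a ^ Suc n"
        by (simp add: field_simps del: fact_Suc flip: cemb_add distrib_right)
      finally show ?thesis
        using True by (simp add: comm del: fact_Suc power_Suc)
    qed (simp add: hexp_def cemb_zero del: fact_Suc)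
  qed
  then show ?thesis
    by (simp add: qnum_def qnum_quotient_def mult.assoc)
qed

lemma qnum_quotient_minus: "qnum_quotient (- a) = qnum_quotient a"
proof -
  have "cemb ((1 + (- 1) ^ n) / fact (Suc n)) * (- a) ^ n = cemb ((1 +
      (- 1) ^ n) / fact (Suc n)) * a ^ n" for n
    by (cases "even n") (simp_all add: cemb_zero del: fact_Suc)
  then show ?thesis by (simp add: qnum_quotient_def)
qed

lemma qnum_quotient_nth_0: "qnum_quotient a $ 0 = 1"
  by (simp add: qnum_quotient_def hexp_def cemb_complex_def cemb_one flip: cemb_mult)

lemma fps_map_qnum_quotient:
  "complex_alg_hom h \<Longrightarrow> fps_map h (qnum_quotient a) = qnum_quotient (h a)"
  by (simp add: qnum_quotient_def fps_map_mult fps_map_hemb)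
    (simp add: fps_map_def complex_alg_hom_simps complex_alg_hom_power)

lemma qratio_eq:
  assumes "a \<noteq> 0" "b \<noteq> 0"
  shows "qratio a b = qnum_quotient a * qnum_quotient b"
proof (rule fps_ext)
  fix n
  have "qnum a * qnum b = fps_const (a * b) * (qnum_quotient a * qnum_quotient b)"
    by (simp add: qnum_eq algebra_simps flip: fps_const_mult)
  then show "qratio a b $ n = (qnum_quotient a * qnum_quotient b) $ n"
    using assms by (simp add: qratio_def)
qed

section \<open>The coefficients of \<open>\<phi>\<close>\<close>

lemma hexp_complex: "hexp c = fps_exp (c::complex)"
  by (simp add: hexp_def fps_eq_iff cemb_complex_def)

lemma hexp_complex_add: "hexp (a + b) = hexp a * hexp (b::complex)"
  by (simp add: hexp_complex fps_exp_add_mult)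

text \<open>The series \<open>[n]!/n!\<close>; unlike \<open>[n]!\<close> it has constant term \<open>1\<close>.\<close>

definition qfact_quotient :: "nat \<Rightarrow> complex fps" where
  "qfact_quotient n = (\<Prod>i=1..n. qnum_quotient (of_nat i))"

lemma qfact_quotient_Suc: "qfact_quotient (Suc n) = qfact_quotient n *
    qnum_quotient (of_nat (Suc n))"
  by (simp add: qfact_quotient_def del: of_nat_Suc)

lemma qfact_quotient_nth_0: "qfact_quotient n $ 0 = 1"
  by (induction n) (simp add: qfact_quotient_def, simp add: qfact_quotient_Suc qnum_quotient_nth_0)

lemma qfact_eq: "qfact n = fps_const (fact n) * qfact_quotient n"
proof (induction n)
  case (Suc n)
  have "qfact (Suc n) = qfact n * qnum (of_nat (Suc n))"
    by (simp add: qfact_def del: of_nat_Suc)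
  then show ?case
    unfolding Suc qfact_quotient_Suc by (simp add: qnum_eq mult_ac flip: fps_const_mult)
qed (simp add: qfact_def qfact_quotient_def)

lemma qbinom_eq:
  "qbinom (k + l) k * (qfact_quotient k * qfact_quotient l) =
     fps_const (of_nat ((k + l) choose k)) * (hexp (- of_nat (k * l)) * qfact_quotient (k + l))"
proof -
  let ?f = "fps_const (fact l * fact k :: complex)" and ?c = "fps_const (of_nat ((k +
      l) choose k) :: complex)"
  have unit: "(qfact l * qfact k) $ 0 \<noteq> 0"
    by (simp add: qfact_eq qfact_quotient_nth_0)
  then have "qfact (k + l) / (qfact l * qfact k) * (qfact l * qfact k) = qfact (k + l)"
    by (simp only: fps_divide_unit mult.assoc inverse_mult_eq_1 mult_1_right not_False_eq_True)
  then have binom: "qbinom (k + l) k * (qfact l * qfact k) =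
      hexp (of_nat k * (of_nat k - of_nat (k + l))) * qfact (k + l)"
    by (simp only: qbinom_def mult.assoc add_diff_cancel_left')
  have exponent: "of_nat k * (of_nat k - of_nat (k + l)) = (- of_nat (k * l) :: complex)"
    by (simp add: algebra_simps)
  have denominator: "qfact l * qfact k = ?f * (qfact_quotient k * qfact_quotient l)"
    by (simp add: qfact_eq mult_ac flip: fps_const_mult)
  have numerator: "qfact (k + l) = ?f * ?c * qfact_quotient (k + l)"
  proof -
    have "fact (k + l) = fact l * fact k * (of_nat ((k + l) choose k) :: complex)"
      by (simp add: binomial_fact[of k "k + l"])
    then show ?thesis by (simp only: qfact_eq fps_const_mult)
  qed
  have "?f * (qbinom (k + l) k * (qfact_quotient k * qfact_quotient l)) =
     ?f * (?c * (hexp (- of_nat (k * l)) * qfact_quotient (k + l)))"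
    using binom unfolding exponent denominator numerator by (simp only: mult_ac)
  then show ?thesis
    by (rule mult_left_cancel[THEN iffD1, rotated]) simp
qed

lemma qbinom_nth_0: "qbinom (k + l) k $ 0 = of_nat ((k + l) choose k)"
  using arg_cong[OF qbinom_eq[of k l], of "\<lambda>f. f $ 0"]
  by (simp add: qfact_quotient_nth_0 hexp_complex)

lemma
  shows phi_coeff_nth_0: "phi_coeff k l $ 0 = 1"
    and phi_coeff_square: "phi_coeff k l * phi_coeff k l * (qfact_quotient k * qfact_quotient l) =
          hexp (- of_nat (k * l)) * qfact_quotient (k + l)"
proof -
  let ?b = "real ((k + l) choose k)"
  have b: "?b > 0" by (simp add: zero_less_binomial)
  have q0: "qbinom (k + l) k $ 0 = cemb (complex_of_real ?b)"
    by (simp add: qbinom_nth_0 cemb_complex_def)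
  have root: "complex_of_real (sqrt ?b) * complex_of_real (1 / sqrt ?b) = 1"
    using b by (subst of_real_mult[symmetric]) simp
  then show "phi_coeff k l $ 0 = 1"
    by (simp only: phi_coeff_def fps_mult_right_const_nth hsqrt_nth_0[OF b q0] cemb_complex_def)
  have inv: "fps_const (complex_of_real (1 / sqrt ?b)) * fps_const (complex_of_real (1 / sqrt ?b)) *
      fps_const (complex_of_real ?b) = 1"
  proof -
    have "1 / sqrt ?b * (1 / sqrt ?b) * ?b = 1"
      using b by simp
    then show ?thesis
      by (simp only: fps_const_mult of_real_1 fps_const_1_eq_1 flip: of_real_mult)
  qed
  have "phi_coeff k l * phi_coeff k l * (qfact_quotient k * qfact_quotient l) =
      (fps_const (complex_of_real (1 / sqrt ?b)) * fps_const (complex_of_real (1 / sqrt ?b))) *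
      ((hsqrt (qbinom (k + l) k) * hsqrt (qbinom (k + l) k)) * (qfact_quotient k *
          qfact_quotient l))"
    unfolding phi_coeff_def by (simp only: mult_ac)
  also have "\<dots> = (fps_const (complex_of_real (1 / sqrt ?b)) *
      fps_const (complex_of_real (1 / sqrt ?b)) *
      fps_const (complex_of_real ?b)) * (hexp (- of_nat (k * l)) * qfact_quotient (k + l))"
    unfolding hsqrt_mult_self[OF b q0] qbinom_eq by (simp only: mult_ac of_real_of_nat_eq)
  finally show "phi_coeff k l * phi_coeff k l * (qfact_quotient k * qfact_quotient l) =
          hexp (- of_nat (k * l)) * qfact_quotient (k + l)"
    unfolding inv by simp
qed

text \<open>Both sides, multiplied by \<open>[k]! [l]! / (k! l!)\<close>, are multiples of \<open>[k+l+1]!/(k+l+1)!\<close>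
  by the exponentials \<open>e\<^bsup>-\<hbar>k(l+1)\<^esup>\<close> and \<open>e\<^bsup>\<hbar>(l-k)\<^esup>e\<^bsup>-\<hbar>(k+1)l\<^esup>\<close>, which coincide.\<close>

lemma phi_coeff_ratio:
  "phi_coeff k (Suc l) * phi_coeff k (Suc l) * qnum_quotient (of_nat (Suc l)) =
     hexp (of_nat l - of_nat k) * (phi_coeff (Suc k) l * phi_coeff (Suc k) l *
         qnum_quotient (of_nat (Suc k)))"
proof -
  let ?u = "qfact_quotient k * qfact_quotient l"
  let ?a = "phi_coeff k (Suc l) * phi_coeff k (Suc l) * qnum_quotient (of_nat (Suc l))"
  let ?b = "phi_coeff (Suc k) l * phi_coeff (Suc k) l * qnum_quotient (of_nat (Suc k))"
  have a: "?a * ?u = hexp (- of_nat (k * Suc l)) * qfact_quotient (k + Suc l)"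
    using phi_coeff_square[of k "Suc l"] by (simp add: qfact_quotient_Suc mult_ac del: of_nat_Suc)
  have b: "?b * ?u = hexp (- of_nat (Suc k * l)) * qfact_quotient (k + Suc l)"
    using phi_coeff_square[of "Suc k" l] by (simp add: qfact_quotient_Suc mult_ac del: of_nat_Suc)
  have "- of_nat (k * Suc l) = (of_nat l - of_nat k) + - of_nat (Suc k * l) + (0 :: complex)"
    by (simp add: algebra_simps)
  then have "hexp (- of_nat (k * Suc l)) = hexp (of_nat l - of_nat k) * hexp (- of_nat (Suc k *
      l) :: complex)"
    by (simp only: add_0_right hexp_complex_add)
  then have eq: "?a * ?u = (hexp (of_nat l - of_nat k) * ?b) * ?u"
    unfolding a mult.assoc[of _ ?b] b by (simp only: mult.assoc)
  have "?u $ 0 = 1" by (simp add: qfact_quotient_nth_0)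
  then have "?u \<noteq> 0" by (metis fps_zero_nth zero_neq_one)
  then show ?thesis
    using eq by (rule mult_right_cancel[THEN iffD1])
qed

section \<open>Linearity of \<open>\<phi>\<close>\<close>

abbreviation ordered_word :: "nat \<Rightarrow> nat \<Rightarrow> plane_gen free fps" where
  "ordered_word k l \<equiv> fps_const (gen GenX ^ k * gen GenY ^ l)"

lemma phi_hextend: "phi p = abs_xh (hextend phi_poly p)"
  by (simp add: phi_def hextend_def)

text \<open>A common range of summation for all polynomials of bounded degrees makes additivity
  visible.\<close>

lemma phi_poly_bound:
  assumes "degree p \<le> n" "\<And>l. degree (coeff p l) \<le> n"
  shows "phi_poly p = (\<Sum>l\<le>n. \<Sum>k\<le>n. fps_const (cemb (coeff (coeff p l) k)) *
      hscale (phi_coeff k l) (ordered_word k l))"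
proof -
  let ?t = "\<lambda>l k. fps_const (cemb (coeff (coeff p l) k)) *
      hscale (phi_coeff k l) (ordered_word k l)"
  have "phi_poly p = (\<Sum>l\<le>degree p. \<Sum>k\<le>degree (coeff p l). ?t l k)"
    by (simp add: phi_poly_def hscale_def hemb_mult mult.assoc)
  also have "\<dots> = (\<Sum>l\<le>degree p. \<Sum>k\<le>n. ?t l k)"
    using assms(2) by (intro sum.cong sum.mono_neutral_left) (auto simp: coeff_eq_0 cemb_zero)
  also have "\<dots> = (\<Sum>l\<le>n. \<Sum>k\<le>n. ?t l k)"
    using assms(1) by (intro sum.mono_neutral_left) (auto simp: coeff_eq_0 cemb_zero)
  finally show ?thesis .
qed

lemma degree_coeff_bounded: "\<exists>n. degree (p :: complex poly poly) \<le> n \<and> (\<forall>l. degree (coeff p l) \<le> n)"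
proof -
  let ?S = "insert (degree p) ((\<lambda>l. degree (coeff p l)) ` {..degree p})"
  have "degree (coeff p l) \<le> Max ?S" for l
  proof (cases "l \<le> degree p")
    case True
    then show ?thesis by (intro Max_ge) auto
  qed (simp add: coeff_eq_0)
  then show ?thesis by (intro exI[of _ "Max ?S"]) auto
qed

lemma phi_poly_add: "phi_poly (p + q) = phi_poly p + phi_poly q"
proof -
  obtain m n where mn: "degree p \<le> m" "\<And>l. degree (coeff p l) \<le> m"
    "degree q \<le> n" "\<And>l. degree (coeff q l) \<le> n"
    using degree_coeff_bounded by metis
  then have p: "degree p \<le> max m n" "\<And>l. degree (coeff p l) \<le> max m n"
    and q: "degree q \<le> max m n" "\<And>l. degree (coeff q l) \<le> max m n"
    by (simp_all add: le_max_iff_disj)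
  then have pq: "degree (p + q) \<le> max m n" "\<And>l. degree (coeff (p + q) l) \<le> max m n"
    unfolding coeff_add by (intro degree_add_le; simp)+
  show ?thesis
    by (simp add: phi_poly_bound[OF p] phi_poly_bound[OF q] phi_poly_bound[OF pq]
        cemb_add distrib_right sum.distrib flip: fps_const_add)
qed

lemma phi_poly_cemb: "phi_poly (cemb c * p) = fps_const (cemb c) * phi_poly p"
proof -
  obtain n where n: "degree p \<le> n" "\<And>l. degree (coeff p l) \<le> n"
    using degree_coeff_bounded by metis
  have coeff: "coeff (cemb c * p) l = smult c (coeff p l)" for l
    by (simp add: cemb_poly_def cemb_complex_def)
  have deg: "degree (cemb c * p) \<le> n" "degree (coeff (cemb c * p) l) \<le> n" for l
    unfolding coeff using n degree_smult_le[of c] degree_smult_le[of "cemb c" p]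
    by (auto simp: cemb_poly_def intro: order_trans)
  show ?thesis
    by (subst (1 2) phi_poly_bound[of _ n])
      (auto intro!: deg n simp: coeff cemb_mult sum_distrib_left mult.assoc simp flip:
          fps_const_mult)
qed

lemma phi_poly_0: "phi_poly 0 = 0"
  using phi_poly_add[of 0 0] by simp

lemma module_hom_hextend_phi_poly: "module_hom hscale hscale (hextend phi_poly)"
  by (intro hextend_module_hom phi_poly_add phi_poly_cemb)

lemma module_hom_phi: "module_hom hscale hscale phi"
  unfolding phi_hextend[abs_def]
  by (intro module_hom_hscale_compose[OF module_hom_abs_xh] module_hom_hextend_phi_poly)

lemma phi_poly_monomial: "phi_poly (px ^ k * py ^ l) = hscale (phi_coeff k l) (ordered_word k l)"
proof -
  have m: "px ^ k * py ^ l = monom (monom 1 k) l"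
    using cemb_monomial[of 1] by (simp add: cemb_one)
  have bound: "degree (px ^ k * py ^ l) \<le> max k l" "degree (coeff (px ^ k * py ^ l) i) \<le> max k l"
      for i
    by (auto simp: m degree_monom_eq)
  let ?h = "hscale (phi_coeff k l) (ordered_word k l)"
  have "fps_const (cemb (coeff (coeff (px ^ k * py ^ l) l') k')) *
      hscale (phi_coeff k' l') (ordered_word k' l') = (if l' = l \<and> k' = k then ?h else 0)" for k' l'
    by (auto simp: m cemb_one cemb_zero)
  moreover have "(\<Sum>k'\<le>max k l. if l' = l \<and> k' = k then ?h else 0) = (if l' = l then ?h else 0)"
      for l'
    by (cases "l' = l") simp_all
  ultimately show ?thesis
    by (simp only: phi_poly_bound[OF bound]) simp
qed

section \<open>Injectivity of \<open>\<phi>\<close>: coordinates by counting inversions\<close>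

text \<open>The number of pairs consisting of a \<open>y\<close> and a later \<open>x\<close>; this is how often the
  relation has to be applied to order the word.\<close>

fun inversions :: "plane_gen list \<Rightarrow> nat" where
  "inversions [] = 0"
| "inversions (GenX # w) = inversions w"
| "inversions (GenY # w) = count_list w GenX + inversions w"

definition ordering_weight :: "nat \<Rightarrow> nat \<Rightarrow> plane_gen list \<Rightarrow> complex fps" where
  "ordering_weight k l w =
     (if count_list w GenX = k \<and> count_list w GenY = l then hexp (- of_nat (inversions w)) else 0)"

definition coordinate_poly :: "nat \<Rightarrow> nat \<Rightarrow> plane_gen free \<Rightarrow> complex fps" where
  "coordinate_poly k l a =
     (\<Sum>w\<in>Poly_Mapping.keys a. fps_const (Poly_Mapping.lookup a w) *
         ordering_weight k l (letters w))"

lemma coordinate_poly_superset: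
  assumes "finite A" "Poly_Mapping.keys a \<subseteq> A"
  shows "coordinate_poly k l a = (\<Sum>w\<in>A. fps_const (Poly_Mapping.lookup a w) *
      ordering_weight k l (letters w))"
  unfolding coordinate_poly_def using assms
  by (intro sum.mono_neutral_left) (auto simp: in_keys_iff)

lemma coordinate_poly_add: "coordinate_poly k l (a + b) = coordinate_poly k l a +
    coordinate_poly k l b"
proof -
  let ?A = "Poly_Mapping.keys a \<union> Poly_Mapping.keys b"
  show ?thesis
    using Poly_Mapping.keys_add[of a b]
    by (simp add: coordinate_poly_superset[of ?A]
        lookup_add algebra_simps sum.distrib flip: fps_const_add)
qed

lemma coordinate_poly_single:
  "coordinate_poly k l (Poly_Mapping.single (FWord w) c) = fps_const c * ordering_weight k l w"
  by (simp add: coordinate_poly_def)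

lemma coordinate_poly_cemb:
  "coordinate_poly k l (cemb c * a) = fps_const (cemb c) * coordinate_poly k l a"
proof (induction a rule: free_word_induct)
  case (word d w)
  have "cemb c * (cemb d * Poly_Mapping.single (FWord w) 1) = Poly_Mapping.single (FWord w) (c * d)"
    "cemb d * Poly_Mapping.single (FWord w) 1 = Poly_Mapping.single (FWord w) d"
    by (simp_all add: cemb_poly_mapping_def mult_single cemb_complex_def)
  then show ?case
    by (simp add: coordinate_poly_single cemb_complex_def mult.assoc flip: fps_const_mult)
qed (simp add: distrib_left coordinate_poly_add)

abbreviation coordinate :: "nat \<Rightarrow> nat \<Rightarrow> plane_gen free fps \<Rightarrow> complex fps" where
  "coordinate k l \<equiv> hextend (coordinate_poly k l)"

lemma module_hom_coordinate: "module_hom hscale hscale (coordinate k l)"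
  by (intro hextend_module_hom coordinate_poly_add coordinate_poly_cemb)

lemma coordinate_word:
  "coordinate k l (fps_const (Poly_Mapping.single (FWord w) 1)) = ordering_weight k l w"
  using hextend_const[of "coordinate_poly k l"] coordinate_poly_add[of k l 0 0]
  by (simp add: coordinate_poly_single)

lemma inversions_swap: "inversions (u @ GenY # GenX # v) = Suc (inversions (u @ GenX # GenY # v))"
proof (induction u)
  case (Cons g u)
  then show ?case by (cases g) auto
qed simp

lemma ordering_weight_swap:
  "ordering_weight k l (u @ GenX # GenY # v) = hexp 1 * ordering_weight k l (u @ GenY # GenX # v)"
proof -
  have "hexp 1 * hexp (- of_nat (Suc n)) = hexp (- of_nat n :: complex)" for n
    by (simp flip: hexp_complex_add)
  then show ?thesis
    by (auto simp: ordering_weight_def inversions_swap simp del: of_nat_Suc)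
qed

text \<open>On words \<open>u\<close> and \<open>v\<close>, replacing \<open>xy\<close> by \<open>yx\<close> between them creates exactly one
  inversion, whose weight \<open>e\<^bsup>-\<hbar>\<^esup>\<close> cancels the factor \<open>e\<^bsup>\<hbar>\<^esup>\<close> of the relation. Linearity in
  \<open>a\<close> and in \<open>b\<close> does the rest.\<close>

lemma coordinate_relator:
  assumes "r \<in> xh_relators"
  shows "coordinate k l (a * r * b) = 0"
proof -
  let ?xy = "fps_const (gen GenX * gen GenY)" and ?yx = "fps_const (gen GenY * gen GenX)"
  let ?w = "\<lambda>w. fps_const (Poly_Mapping.single (FWord w) 1) :: plane_gen free fps"
  have mult: "module_hom hscale hscale (\<lambda>x. a * x * b)" for a b :: "plane_gen free fps"
    by (rule module_hom_hscaleI) (simp_all add: hscale_def algebra_simps, simp add: hemb_central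
        mult.assoc)
  have left: "module_hom hscale hscale (\<lambda>a. a * (b :: plane_gen free fps))" for b
    by (rule module_hom_hscaleI) (simp_all add: hscale_def algebra_simps)
  have right: "module_hom hscale hscale (\<lambda>b. (a :: plane_gen free fps) * b)" for a
    using mult[of a 1] by simp
  note hom = module_hom_hscale_compose[OF module_hom_coordinate]
  have words: "coordinate k l (?w u * ?xy * ?w v) = hscale (hexp 1) (coordinate k l (?w u * ?yx *
      ?w v))" for u v
    by (simp add: gen_def mult_single plus_fword_def coordinate_word ordering_weight_swap
        hscale_def)
  have "coordinate k l (a * ?xy * ?w v) = hscale (hexp 1) (coordinate k l (a * ?yx * ?w v))" for v
    unfolding mult.assoc
    by (rule module_hom_words_eqI[OF hom[OF left]
          module_hom_hscale_compose[OF module_hom_hscale_fixed hom[OF left]]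
              words[unfolded mult.assoc]])
  then have "coordinate k l (a * ?xy * b) = hscale (hexp 1) (coordinate k l (a * ?yx * b))"
    by (rule module_hom_words_eqI[OF hom[OF right]
          module_hom_hscale_compose[OF module_hom_hscale_fixed hom[OF right]]])
  moreover have "coordinate k l (a * (?xy - hemb (hexp 1) * ?yx) * b) =
      coordinate k l (a * ?xy * b) - hscale (hexp 1) (coordinate k l (a * ?yx * b))"
    by (simp add: module_hom.diff[OF hom[OF mult]] module_hom_hscale[OF hom[OF mult]]
        flip: hscale_def)
  ultimately show ?thesis
    using assms by (simp add: xh_relators_def)
qed

text \<open>The functional vanishes on the ideal, and each coefficient of its value depends on
  finitely many coefficients of the argument, so it vanishes on the closure.\<close>

lemma coordinate_eq_0:
  assumes "a \<in> closure (ideal_gen xh_relators)"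
  shows "coordinate k l a = 0"
proof -
  have zero: "coordinate k l 0 = 0"
    using module_hom_add[OF module_hom_coordinate, of k l 0 0] by simp
  have "two_sided_ideal {a. \<forall>b c. coordinate k l (b * a * c) = 0}"
    by (auto simp: two_sided_ideal_def distrib_left distrib_right zero
        module_hom_add[OF module_hom_coordinate] mult.assoc)
      (metis mult.assoc)
  then have ideal: "ideal_gen xh_relators \<subseteq> {a. \<forall>b c. coordinate k l (b * a * c) = 0}"
    by (rule ideal_gen_least) (auto simp: coordinate_relator)
  show ?thesis
  proof (rule fps_ext)
    fix m
    from assms obtain b where b: "b \<in> ideal_gen xh_relators" "\<forall>i<Suc m. b $ i = a $ i"
      unfolding closure_fps_iff by blast
    then have "coordinate k l a $ m = coordinate k l b $ m"
      by (simp add: hextend_def)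
    also have "coordinate k l b = 0"
      using ideal b(1) by (metis (mono_tags, lifting) mem_Collect_eq mult_1 mult.right_neutral
          subsetD)
    finally show "coordinate k l a $ m = 0 $ m" by simp
  qed
qed

lemma ordered_word_single:
  "gen GenX ^ k * gen GenY ^ l =
      Poly_Mapping.single (FWord (replicate k GenX @ replicate l GenY)) 1"
proof (induction k)
  case 0
  show ?case
    by (induction l) (simp_all add: single_Nil, simp add: single_Cons)
qed (simp add: mult.assoc single_Cons)

lemma ordering_weight_ordered:
  "ordering_weight k l (replicate i GenX @ replicate j GenY) = (if i = k \<and> j = l then 1 else 0)"
proof -
  have "count_list (replicate j GenY) GenX = 0" by (induction j) auto
  moreover have "count_list (replicate j GenY) GenY = j" by (induction j) auto
  moreover from calculation have "inversions (replicate j GenY) = 0" by (induction j) auto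
  ultimately have "inversions (replicate i GenX @ replicate j GenY) = 0"
    "count_list (replicate i GenX @ replicate j GenY) GenX = i"
    "count_list (replicate i GenX @ replicate j GenY) GenY = j"
    by (induction i) auto
  then show ?thesis
    by (cases "i = k \<and> j = l") (auto simp: ordering_weight_def hexp_complex)
qed

text \<open>Ordered words have no inversions, so the functional picks out one coefficient of \<open>p\<close>,
  scaled as \<open>\<phi>\<close> scales it.\<close>

lemma coordinate_phi:
  "coordinate k l (hextend phi_poly p) =
      hscale (phi_coeff k l) (Abs_fps (\<lambda>n. coeff (coeff (p $ n) l) k))"
proof (rule module_hom_xy_eqI[of "\<lambda>p. coordinate k l (hextend phi_poly p)"])
  show "module_hom hscale hscale (\<lambda>p. coordinate k l (hextend phi_poly p))"
    by (intro module_hom_hscale_compose[OF module_hom_coordinate] module_hom_hextend_phi_poly)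
  have coeffs: "module_hom hscale hscale
      (\<lambda>p. Abs_fps (\<lambda>n. coeff (coeff (p $ n) l) k) :: complex fps)"
    by (rule module_hom_hscaleI)
      (auto simp: hscale_def fps_eq_iff fps_mult_nth coeff_sum cemb_poly_def cemb_complex_def)
  show "module_hom hscale hscale
      (\<lambda>p. hscale (phi_coeff k l) (Abs_fps (\<lambda>n. coeff (coeff (p $ n) l) k) :: complex fps))"
    by (rule module_hom_hscale_compose[OF module_hom_hscale_fixed coeffs])
  fix i j
  have m: "px ^ i * py ^ j = monom (monom 1 i) j"
    using cemb_monomial[of 1] by (simp add: cemb_one)
  have "Abs_fps (\<lambda>n. coeff (coeff (fps_const (px ^ i * py ^ j) $ n) l) k) = (if i = k \<and> j =
      l then 1 else 0)"
    by (auto simp: m fps_eq_iff)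
  then show "coordinate k l (hextend phi_poly (fps_const (px ^ i * py ^ j))) =
      hscale (phi_coeff k l) (Abs_fps (\<lambda>n. coeff (coeff (fps_const (px ^ i * py ^ j) $ n) l) k))"
    unfolding hextend_const[of phi_poly, OF phi_poly_0] phi_poly_monomial
      module_hom_hscale[OF module_hom_coordinate] ordered_word_single coordinate_word
    by (auto simp: ordering_weight_ordered hscale_def)
qed

lemma inj_phi: "inj phi"
proof -
  interpret phi: module_hom hscale hscale phi by (rule module_hom_phi)
  have kernel: "p = 0" if "phi p = 0" for p
  proof (intro fps_ext poly_eqI)
    fix n l k
    have "hextend phi_poly p \<in> closure (ideal_gen xh_relators)"
      using that by (simp add: phi_hextend abs_xh_eq_0_iff)
    from coordinate_eq_0[OF this, of k l]
    have "phi_coeff k l * Abs_fps (\<lambda>n. coeff (coeff (p $ n) l) k) = 0"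
      by (simp add: coordinate_phi hscale_def)
    moreover have "phi_coeff k l \<noteq> 0"
      using phi_coeff_nth_0[of k l] by auto
    ultimately have "Abs_fps (\<lambda>n. coeff (coeff (p $ n) l) k) $ n = 0"
      by simp
    then show "coeff (coeff (p $ n) l) k = coeff (coeff (0 $ n) l) k"
      by simp
  qed
  show ?thesis
  proof (rule injI)
    fix p q assume "phi p = phi q"
    then have "phi (p - q) = 0" by (simp add: phi.diff)
    then show "p = q" using kernel[of "p - q"] by simp
  qed
qed

section \<open>Surjectivity of \<open>\<phi>\<close>: ordering of words\<close>

lemma hscale_mult_left: "hscale s a * b = hscale s (a * b)"
  by (simp add: hscale_def mult.assoc)

lemma hscale_mult_right: "a * hscale s b = hscale s (a * b)"
  unfolding hscale_def by (metis hemb_central mult.assoc)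

lemma hscale_one [simp]: "hscale 1 a = a"
  by (simp add: hscale_def hemb_one)

lemma xhgen_Y_X_power:
  "xhgen GenY * xhgen GenX ^ k = hscale (hexp (- of_nat k)) (xhgen GenX ^ k * xhgen GenY)"
proof (induction k)
  case 0
  show ?case by (simp add: hexp_complex)
next
  case (Suc k)
  have YX: "xhgen GenY * xhgen GenX = hscale (hexp (- 1)) (xhgen GenX * xhgen GenY)"
    unfolding xhgen_commute hscale_hscale
    by (subst hexp_complex_add[symmetric]) (simp add: hexp_complex)
  have "xhgen GenY * xhgen GenX ^ Suc k = (xhgen GenY * xhgen GenX) * xhgen GenX ^ k"
    by (simp add: mult.assoc)
  also have "\<dots> = hscale (hexp (- 1)) (xhgen GenX * (xhgen GenY * xhgen GenX ^ k))"
    by (simp add: YX hscale_mult_left mult.assoc)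
  also have "\<dots> = hscale (hexp (- 1) * hexp (- of_nat k)) (xhgen GenX ^ Suc k * xhgen GenY)"
    by (simp add: Suc hscale_mult_right hscale_hscale mult.assoc)
  also have "hexp (- 1) * hexp (- of_nat k) = hexp (- of_nat (Suc k) :: complex)"
    by (simp flip: hexp_complex_add)
  finally show ?case .
qed

lemma word_in_ordered_form:
  "\<exists>s k l. abs_xh (fps_const (Poly_Mapping.single (FWord w) 1)) =
     hscale s (xhgen GenX ^ k * xhgen GenY ^ l)"
proof (induction w)
  case Nil
  have "abs_xh (fps_const (Poly_Mapping.single (FWord []) 1)) = hscale 1 (xhgen GenX ^ 0 *
      xhgen GenY ^ 0)"
    by (simp add: single_Nil flip: one_xh.abs_eq)
  then show ?case by blast
next
  case (Cons g w)
  then obtain s k l where w: "abs_xh (fps_const (Poly_Mapping.single (FWord w) 1)) =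
      hscale s (xhgen GenX ^ k * xhgen GenY ^ l)" by blast
  have "abs_xh (fps_const (Poly_Mapping.single (FWord (g # w)) 1)) =
      xhgen g * hscale s (xhgen GenX ^ k * xhgen GenY ^ l)"
    by (simp add: single_Cons xhgen_def abs_xh_mult w[unfolded xhgen_def] flip: fps_const_mult)
  also have "\<dots> = hscale s (xhgen g * xhgen GenX ^ k * xhgen GenY ^ l)"
    by (simp add: hscale_mult_right mult.assoc)
  finally have *: "abs_xh (fps_const (Poly_Mapping.single (FWord (g # w)) 1)) = \<dots>" .
  show ?case
  proof (cases g)
    case GenX
    with * have "abs_xh (fps_const (Poly_Mapping.single (FWord (g # w)) 1)) =
        hscale s (xhgen GenX ^ Suc k * xhgen GenY ^ l)" by simp
    then show ?thesis by blast
  next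
    case GenY
    with * have "abs_xh (fps_const (Poly_Mapping.single (FWord (g # w)) 1)) =
        hscale (s * hexp (- of_nat k)) (xhgen GenX ^ k * xhgen GenY ^ Suc l)"
      by (simp add: xhgen_Y_X_power hscale_mult_left hscale_hscale mult.assoc)
    then show ?thesis by blast
  qed
qed

text \<open>Since \<open>\<phi>\<close> multiplies ordered monomials by invertible series, every multiple of an
  ordered monomial is attained.\<close>

lemma const_in_range_phi: "abs_xh (fps_const b) \<in> range phi"
proof (induction b rule: free_word_induct)
  case (add a b)
  then obtain p q where "abs_xh (fps_const a) = phi p" "abs_xh (fps_const b) = phi q" by auto
  then have "abs_xh (fps_const (a + b)) = phi (p + q)"
    by (simp add: module_hom_add[OF module_hom_phi] module_hom_add[OF module_hom_abs_xh]
        flip: fps_const_add)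
  then show ?case by blast
next
  case (word c w)
  obtain s k l where w: "abs_xh (fps_const (Poly_Mapping.single (FWord w) 1)) =
      hscale s (xhgen GenX ^ k * xhgen GenY ^ l)"
    using word_in_ordered_form by blast
  have "inverse (phi_coeff k l) * phi_coeff k l = 1"
    by (rule inverse_mult_eq_1) (simp add: phi_coeff_nth_0)
  then have "abs_xh (fps_const (cemb c * Poly_Mapping.single (FWord w) 1)) =
      phi (hscale (fps_const c) (hscale (s * inverse (phi_coeff k l)) (fps_const (px ^ k *
          py ^ l))))"
    by (simp add: module_hom_hscale[OF module_hom_phi] phi_monomial w hscale_hscale mult.assoc
        module_hom_hscale[OF module_hom_abs_xh] flip: hscale_fps_const)
  then show ?case by blast
qed

lemma surj_phi: "surj phi"
proof -
  \<comment> \<open>a \<open>\<complex>\<close>-linear choice of preimages of constants, so that it extends to series\<close>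
  define T where "T b = inv phi (abs_xh (fps_const b))" for b
  have phi_T: "phi (T b) = abs_xh (fps_const b)" for b
    unfolding T_def by (rule f_inv_into_f) (rule const_in_range_phi)
  have "T (a + b) = T a + T b" for a b
    by (rule injD[OF inj_phi])
      (simp add: phi_T module_hom_add[OF module_hom_phi] module_hom_add[OF module_hom_abs_xh]
        flip: fps_const_add)
  then have T: "hbar_additive (hextend T)" "T 0 = 0"
    by (rule hextend_additive) (metis \<open>\<And>b a. T (a + b) = T a +
        T b\<close> add.right_neutral add_cancel_left_right)
  have "phi (hextend T a) = abs_xh a" for a
    by (rule hbar_additive_eqI[OF hbar_additive_compose[OF hbar_additive_module_hom[OF
        module_hom_phi] T(1)]
          hbar_additive_module_hom[OF module_hom_abs_xh]])
      (simp add: hextend_const[of T, OF T(2)] phi_T)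
  then have "\<exists>p. a = phi p" for a
    by (metis Quotient3_abs_rep Quotient3_xh)
  then show ?thesis by (auto simp: surj_def)
qed

lemma bij_phi: "bij phi"
  by (simp add: bij_def inj_phi surj_phi)

section \<open>The undeformed action\<close>

lemma usl2_act_add: "usl2_act (a + b) p = usl2_act a p + usl2_act b p"
  by transfer (rule free_act_add)

lemma usl2_act_arg_add: "usl2_act a (p + q) = usl2_act a p + usl2_act a q"
  by transfer (rule free_act_arg_add)

lemma usl2_act_mult: "usl2_act (a * b) p = usl2_act a (usl2_act b p)"
  by transfer (rule free_act_mult)

lemma usl2_act_cemb: "usl2_act (cemb c) p = cemb c * p"
  by transfer (simp add: cemb_poly_mapping_def free_act_single zero_fword_def cemb_complex_def)

lemma usl2_act_gen: "usl2_act (ugen g) p = gen_act g p"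
  unfolding ugen_def by (simp add: usl2_act.abs_eq free_act_gen)

lemma usl2_act_zero [simp]: "usl2_act 0 p = 0"
  using usl2_act_add[of 0 0] by simp

lemma usl2_act_arg_zero [simp]: "usl2_act a 0 = 0"
  using usl2_act_arg_add[of a 0 0] by simp

lemma usl2_act_arg_cemb: "usl2_act a (cemb c * p) = cemb c * usl2_act a p"
  by (metis usl2_act_cemb usl2_act_mult cemb_central)

lemma usl2_act_sum: "usl2_act (sum f A) p = (\<Sum>i\<in>A. usl2_act (f i) p)"
  by (induction A rule: infinite_finite_induct) (simp_all add: usl2_act_add)

lemma rho_fps_const: "rho (fps_const a) p = Abs_fps (\<lambda>n. usl2_act a (p $ n))"
proof -
  have "(\<Sum>i\<le>n. usl2_act (fps_const a $ i) (p $ (n - i))) = (\<Sum>i\<le>n. if i =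
      0 then usl2_act a (p $ n) else 0)" for n
    by (intro sum.cong) auto
  then show ?thesis by (simp add: rho_def)
qed

lemma rho_arg_fps_const: "rho u (fps_const p) = Abs_fps (\<lambda>n. usl2_act (u $ n) p)"
proof -
  have "(\<Sum>i\<le>n. usl2_act (u $ i) (fps_const p $ (n - i))) = (\<Sum>i\<le>n. if i =
      n then usl2_act (u $ n) p else 0)" for n
    by (intro sum.cong) auto
  then show ?thesis by (simp add: rho_def)
qed

lemma hbar_additive_rho: "hbar_additive (\<lambda>u. rho u p)"
proof (rule hbar_additiveI)
  fix u
  show "rho (hemb fps_X * u) p = hemb fps_X * rho u p"
  proof (rule fps_ext)
    fix m
    show "rho (hemb fps_X * u) p $ m = (hemb fps_X * rho u p) $ m"
      by (cases m) (simp_all add: rho_def sum.atMost_Suc_shift del: sum.atMost_Suc)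
  qed
qed (simp add: rho_def fps_eq_iff usl2_act_add sum.distrib)

lemma hbar_additive_rho_arg: "hbar_additive (rho u)"
proof (rule hbar_additiveI)
  fix p
  show "rho u (hemb fps_X * p) = hemb fps_X * rho u p"
  proof (rule fps_ext)
    fix m
    show "rho u (hemb fps_X * p) $ m = (hemb fps_X * rho u p) $ m"
      by (cases m) (simp_all add: rho_def Suc_diff_le)
  qed
qed (simp add: rho_def fps_eq_iff usl2_act_arg_add sum.distrib)

lemma module_hom_rho: "module_hom hscale hscale (\<lambda>u. rho u p)"
  by (rule hbar_additive_imp_module_hom[OF hbar_additive_rho])
    (simp add: rho_fps_const fps_eq_iff usl2_act_mult usl2_act_cemb)

lemma module_hom_rho_arg: "module_hom hscale hscale (rho u)"
  by (rule hbar_additive_imp_module_hom[OF hbar_additive_rho_arg])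
    (simp add: rho_arg_fps_const fps_eq_iff usl2_act_arg_cemb)

text \<open>For constant series this is multiplicativity of the action of the enveloping algebra;
  the general case follows from linearity in each of the two factors.\<close>

lemma rho_mult: "rho (u * v) p = rho u (rho v p)"
proof -
  have both: "rho (fps_const a * fps_const b) p = rho (fps_const a) (rho (fps_const b) p)" for a b
    by (simp add: rho_fps_const usl2_act_mult)
  have left: "rho (fps_const a * v) p = rho (fps_const a) (rho v p)" for a v
    by (rule hbar_additive_eqI[OF hbar_additive_compose[OF hbar_additive_rho
        hbar_additive_mult_left]
          hbar_additive_compose[OF hbar_additive_rho_arg hbar_additive_rho] both])
  show ?thesis
    by (rule hbar_additive_eqI[OF hbar_additive_compose[OF hbar_additive_rho
        hbar_additive_mult_right]
          hbar_additive_rho left])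
qed

lemma px_mult_monom: "px * monom (monom c k) l = monom (monom c (Suc k)) l"
  and py_mult_monom: "py * monom d l = monom d (Suc l)"
proof -
  have px: "px = monom (monom 1 1) 0" and py: "py = monom 1 1"
    by (simp_all add: px_def py_def monom_altdef)
  show "px * monom (monom c k) l = monom (monom c (Suc k)) l" "py * monom d l = monom d (Suc l)"
    unfolding px py mult_monom by simp_all
qed

lemma monomial_eq: "px ^ k * py ^ l = monom (monom 1 k) l"
  using cemb_monomial[of 1] by (simp add: cemb_one)

lemma dx_monom: "dx (monom (monom c k) l) = monom (monom (of_nat k * c) (k - 1)) l"
  by (simp add: map_poly_monom pderiv_monom)

lemma dy_monom: "dy (monom (monom c k) l) = monom (monom (of_nat l * c) k) (l - 1)"
proof -
  have "of_nat l * monom c k = monom (of_nat l * c) k" for c :: complex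
    by (simp add: of_nat_poly smult_monom)
  then show ?thesis by (simp add: pderiv_monom)
qed

lemma E_monomial:
  "usl2_act (ugen GenE) (px ^ k * py ^ l) = cemb (of_nat k) * (px ^ (k - 1) * py ^ Suc l)"
  by (simp only: cemb_monomial) (simp add: usl2_act_gen monomial_eq dx_monom py_mult_monom)

lemma F_monomial:
  "usl2_act (ugen GenF) (px ^ k * py ^ l) = cemb (of_nat l) * (px ^ Suc k * py ^ (l - 1))"
  by (simp only: cemb_monomial) (simp add: usl2_act_gen monomial_eq dy_monom px_mult_monom)

lemma H_monomial:
  "usl2_act (ugen GenH) (px ^ k * py ^ l) = cemb (of_nat l - of_nat k) * (px ^ k * py ^ l)"
proof -
  have "py * dy (monom (monom 1 k) l) = monom (monom (of_nat l) k) l"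
    unfolding dy_monom py_mult_monom by (cases l) simp_all
  moreover have "px * dx (monom (monom 1 k) l) = monom (monom (of_nat k) k) l"
    unfolding dx_monom px_mult_monom by (cases k) simp_all
  ultimately show ?thesis
    by (simp only: cemb_monomial) (simp add: usl2_act_gen monomial_eq diff_monom)
qed

lemma uM_monomial:
  "usl2_act uM (px ^ k * py ^ l) = cemb ((of_nat l - of_nat k) / 2) * (px ^ k * py ^ l)"
  by (simp add: uM_def usl2_act_mult usl2_act_cemb H_monomial usl2_act_arg_cemb flip: cemb_mult
      mult.assoc)

text \<open>With \<open>j\<close> the value of \<open>J\<close>, this is the relation \<open>C = 2J(J + 1)\<close>.\<close>

lemma uC_monomial:
  fixes k l :: nat
  defines "j \<equiv> (of_nat k + of_nat l) / 2"
  shows "usl2_act uC (px ^ k * py ^ l) = cemb (2 * j * (j + 1)) * (px ^ k * py ^ l)"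
proof -
  let ?w = "px ^ k * py ^ l"
  have "usl2_act (ugen GenE * ugen GenF) ?w = cemb (of_nat l * of_nat (Suc k)) * ?w"
    by (cases l) (simp_all only: usl2_act_mult F_monomial usl2_act_arg_cemb E_monomial cemb_mult
        mult.assoc
      diff_Suc_1 diff_0_eq_0 of_nat_0 cemb_zero mult_zero_left usl2_act_arg_zero)
  moreover have "usl2_act (ugen GenF * ugen GenE) ?w = cemb (of_nat k * of_nat (Suc l)) * ?w"
    by (cases k) (simp_all only: usl2_act_mult F_monomial usl2_act_arg_cemb E_monomial cemb_mult
        mult.assoc
      diff_Suc_1 diff_0_eq_0 of_nat_0 cemb_zero mult_zero_left usl2_act_arg_zero)
  moreover have "usl2_act (cemb (1 / 2) * ugen GenH ^ 2) ?w =
      cemb (1 / 2 * ((of_nat l - of_nat k) * (of_nat l - of_nat k))) * ?w"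
    by (simp only: usl2_act_mult power2_eq_square usl2_act_cemb H_monomial usl2_act_arg_cemb)
      (simp only: cemb_mult mult_ac)
  ultimately have "usl2_act uC ?w = cemb (of_nat l * of_nat (Suc k) + of_nat k * of_nat (Suc l) +
      1 / 2 * ((of_nat l - of_nat k) * (of_nat l - of_nat k))) * ?w"
    by (simp only: uC_def usl2_act_add cemb_add distrib_right)
  also have "of_nat l * of_nat (Suc k) + of_nat k * of_nat (Suc l) +
      1 / 2 * ((of_nat l - of_nat k) * (of_nat l - of_nat k)) = 2 * j * (j + 1 :: complex)"
    by (simp add: j_def field_simps)
  finally show ?thesis .
qed

section \<open>Symmetric polynomials in \<open>M\<close> and \<open>J\<close> acting on monomials\<close>

definition acts_as :: "usl2 \<Rightarrow> complex poly poly \<Rightarrow> complex \<Rightarrow> bool" where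
  "acts_as a w c \<longleftrightarrow> usl2_act a w = cemb c * w"

lemma acts_as_mult: "acts_as a w c \<Longrightarrow> acts_as b w d \<Longrightarrow> acts_as (a * b) w (c * d)"
  by (simp add: acts_as_def usl2_act_mult usl2_act_arg_cemb cemb_mult mult.assoc mult.left_commute)

lemma acts_as_power: "acts_as a w c \<Longrightarrow> acts_as (a ^ n) w (c ^ n)"
proof (induction n)
  case 0
  show ?case
    using usl2_act_cemb[of 1 w] by (simp add: acts_as_def cemb_one)
qed (simp add: acts_as_mult)

lemma acts_as_cemb: "acts_as (cemb c) w c"
  by (simp add: acts_as_def usl2_act_cemb)

lemma acts_as_sum: "(\<And>i. i \<in> A \<Longrightarrow> acts_as (f i) w (c i)) \<Longrightarrow> acts_as (sum f A) w (\<Sum>i\<in>A. c i)"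
  by (simp add: acts_as_def usl2_act_sum cemb_sum sum_distrib_right)

lemma acts_as_eval_MC:
  assumes "acts_as uM w m" "acts_as uC w c"
  shows "acts_as (eval_MC t) w (poly (poly t [:c:]) m)"
proof -
  have "poly (poly t [:c:]) m = (\<Sum>j\<le>degree t. \<Sum>i\<le>degree (coeff t j). coeff (coeff t j) i * m ^ i *
      c ^ j)"
    unfolding poly_altdef[of t] by (simp add: poly_sum poly_power poly_altdef[of "coeff t _"]
        sum_distrib_right)
  then show ?thesis
    unfolding eval_MC_def by (simp only:) (intro acts_as_sum acts_as_mult acts_as_power
        acts_as_cemb assms)
qed

definition reflect_J :: "complex poly poly \<Rightarrow> complex poly poly" where
  "reflect_J s = pcompose s (- pJ - 1)"

definition eval_at :: "complex \<Rightarrow> complex \<Rightarrow> complex poly poly \<Rightarrow> complex" where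
  "eval_at m j s = poly (poly s [:j:]) m"

lemma complex_alg_hom_reflect_J: "complex_alg_hom reflect_J"
  by (auto simp: complex_alg_hom_def reflect_J_def pcompose_add pcompose_mult cemb_poly_def)

lemma complex_alg_hom_eval_at: "complex_alg_hom (eval_at m j)"
  by (auto simp: complex_alg_hom_def eval_at_def cemb_poly_def cemb_complex_def)

lemma J_substitution: "2 * pJ * (pJ + 1) = [:0, 2, 2:]"
  by (simp add: pJ_def numeral_poly one_pCons)

lemma J_reflection: "- pJ - 1 = [:-1, -1:]"
  by (simp add: pJ_def one_pCons)

lemma pcompose_J_inj:
  assumes "pcompose t (2 * pJ * (pJ + 1)) = pcompose t' (2 * pJ * (pJ + 1))"
  shows "t = t'"
proof -
  have "pcompose (t - t') (2 * pJ * (pJ + 1)) = 0"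
    using assms by (simp add: pcompose_diff)
  then show ?thesis
    using pcompose_eq_0[of "t - t'" "2 * pJ * (pJ + 1)"] by (simp add: J_substitution)
qed

text \<open>The symmetry exchanges \<open>0\<close> and \<open>-1\<close>, so \<open>s - s(0)\<close> vanishes at both and is divisible
  by \<open>J(J + 1)\<close>. The quotient is again symmetric and has smaller degree.\<close>

lemma symmetric_is_polynomial_in_C:
  assumes "reflect_J s = s"
  shows "\<exists>t. pcompose t (2 * pJ * (pJ + 1)) = s"
  using assms
proof (induction "degree s" arbitrary: s rule: less_induct)
  case less
  obtain a q where s: "s = pCons a q" by (cases s)
  have "poly s (- 1) = poly (reflect_J s) (- 1)" using less.prems by simp
  also have "\<dots> = a"
    by (simp add: reflect_J_def J_reflection poly_pcompose s)
  finally have "poly q (- 1) = 0" by (simp add: s)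
  then have "[:1, 1:] dvd q"
    by (simp add: poly_eq_0_iff_dvd)
  then obtain r where q: "q = [:1, 1:] * r" ..
  have s': "s = [:a:] + [:0, 1, 1:] * r"
    by (simp add: s q)
  have "pcompose [:0, 1, 1:] [:- 1, - 1:] = ([:0, 1, 1:] :: complex poly poly)"
    by (simp add: pcompose_pCons)
  then have "[:a:] + [:0, 1, 1:] * reflect_J r = [:a:] + [:0, 1, 1:] * r"
    using less.prems unfolding reflect_J_def J_reflection s' pcompose_add pcompose_mult by simp
  then have "[:0, 1, 1:] * reflect_J r = [:0, 1, 1:] * r"
    by (rule add_left_imp_eq)
  then have r: "reflect_J r = r"
    by (rule mult_left_cancel[THEN iffD1, rotated]) simp
  show ?case
  proof (cases "r = 0")
    case True
    then show ?thesis by (intro exI[of _ "[:a:]"]) (simp add: s q)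
  next
    case False
    then have "degree q = degree [:1, 1 :: complex poly:] + degree r"
      unfolding q by (intro degree_mult_eq) auto
    then have "degree q = Suc (degree r)" by simp
    then have "degree r < degree s"
      by (auto simp: s)
    from less.hyps[OF this r] obtain t where t: "pcompose t (2 * pJ * (pJ + 1)) = r" ..
    have "smult [:1 / 2:] (smult [:2:] x) = x" for x :: "complex poly poly"
      by (simp flip: one_pCons)
    then have "pcompose (pCons a (smult [:1 / 2:] t)) (2 * pJ * (pJ + 1)) = s"
      using t unfolding J_substitution s'
      by (simp add: pcompose_pCons pcompose_smult numeral_poly smult_add_right)
    then show ?thesis ..
  qed
qed

lemma acts_as_eval_MJ:
  assumes M: "acts_as uM w m" and C: "acts_as uC w (2 * j * (j + 1))" and s: "reflect_J s = s"
  shows "acts_as (eval_MJ s) w (eval_at m j s)"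
proof -
  obtain t where t: "pcompose t (2 * pJ * (pJ + 1)) = s"
    using symmetric_is_polynomial_in_C[OF s] by blast
  have "(THE t. pcompose t (2 * pJ * (pJ + 1)) = s) = t"
    using t pcompose_J_inj by (intro the_equality) auto
  then have "eval_MJ s = eval_MC t" by (simp only: eval_MJ_def)
  moreover have "poly (2 * pJ * (pJ + 1)) [:j:] = [:2 * j * (j + 1):]"
    unfolding J_substitution by (simp add: numeral_poly algebra_simps)
  then have "eval_at m j s = poly (poly t [:2 * j * (j + 1):]) m"
    unfolding eval_at_def t[symmetric] by (simp add: poly_pcompose)
  ultimately show ?thesis
    using acts_as_eval_MC[OF M C] by simp
qed

text \<open>The values of \<open>M\<close> and \<open>J\<close> on \<open>x\<^sup>ky\<^sup>l\<close>.\<close>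

abbreviation wt_M :: "nat \<Rightarrow> nat \<Rightarrow> complex" where "wt_M k l \<equiv> (of_nat l - of_nat k) / 2"
abbreviation wt_J :: "nat \<Rightarrow> nat \<Rightarrow> complex" where "wt_J k l \<equiv> (of_nat k + of_nat l) / 2"

lemma rho_heval_MJ:
  assumes "fps_map reflect_J f = f"
  shows "rho (heval_MJ f) (fps_const (px ^ k * py ^ l)) =
    hscale (fps_map (eval_at (wt_M k l) (wt_J k l)) f) (fps_const (px ^ k * py ^ l))"
proof (rule fps_ext)
  fix n
  have "acts_as (eval_MJ (f $ n)) (px ^ k * py ^ l) (eval_at (wt_M k l) (wt_J k l) (f $ n))"
    using assms uM_monomial uC_monomial
        by (intro acts_as_eval_MJ) (auto simp: acts_as_def fps_eq_iff)
  then show "rho (heval_MJ f) (fps_const (px ^ k * py ^ l)) $ n =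
      hscale (fps_map (eval_at (wt_M k l) (wt_J k l)) f) (fps_const (px ^ k * py ^ l)) $ n"
    by (simp add: rho_arg_fps_const heval_MJ_def acts_as_def hscale_def)
qed

lemma fps_map_qratio_root:
  fixes h :: "complex poly poly \<Rightarrow> 'b::{idom, complex_alg}"
  assumes a: "a \<noteq> 0" and b: "b \<noteq> 0" and h: "complex_alg_hom h"
  shows "fps_map h (hsqrt (qratio a b)) = hsqrt (qnum_quotient (h a) * qnum_quotient (h b))"
proof -
  have "qratio a b $ 0 = cemb (complex_of_real 1)"
    by (simp add: qratio_eq[OF a b] qnum_quotient_nth_0 cemb_one)
  then have "fps_map h (hsqrt (qratio a b)) = hsqrt (fps_map h (qratio a b))"
    by (rule fps_map_hsqrt[OF h zero_less_one])
  then show ?thesis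
    by (simp add: qratio_eq[OF a b] fps_map_mult[OF h] fps_map_qnum_quotient[OF h])
qed

text \<open>The factors by which \<open>\<alpha>\<^bsup>-1\<^esup>\<close> multiplies \<open>E\<close> and \<open>F\<close>.\<close>

definition alpha_inv_E :: "complex poly poly fps" where
  "alpha_inv_E = hexp (pM + 1) * hsqrt (qratio (pJ + pM + 1) (pJ - pM))"

definition alpha_inv_F :: "complex poly poly fps" where
  "alpha_inv_F = hexp (- pM) * hsqrt (qratio (pJ + pM) (pJ - pM + 1))"

lemma nonzero_factors:
  "pJ + pM + 1 \<noteq> 0" "pJ - pM \<noteq> 0" "pJ + pM \<noteq> 0" "pJ - pM + 1 \<noteq> 0"
  by (simp_all add: pJ_def pM_def one_pCons)

lemma reflect_J_values:
  "reflect_J (pJ + pM + 1) = - (pJ - pM)" "reflect_J (pJ - pM) = - (pJ + pM + 1)"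
  "reflect_J (pJ + pM) = - (pJ - pM + 1)" "reflect_J (pJ - pM + 1) = - (pJ + pM)"
  "reflect_J (pM + 1) = pM + 1" "reflect_J (- pM) = - pM"
  by (simp_all add: reflect_J_def pJ_def pM_def one_pCons pcompose_pCons)

text \<open>The reflection exchanges, up to sign, the two arguments under the root; \<open>[a]/a\<close> is
  even, and the symmetric radicand has a unique positive root.\<close>

lemma reflect_J_alpha_inv: "fps_map reflect_J alpha_inv_E = alpha_inv_E"
    "fps_map reflect_J alpha_inv_F = alpha_inv_F"
  unfolding alpha_inv_E_def alpha_inv_F_def fps_map_mult[OF complex_alg_hom_reflect_J]
    fps_map_hexp[OF complex_alg_hom_reflect_J] reflect_J_values
    fps_map_qratio_root[OF nonzero_factors(1,2) complex_alg_hom_reflect_J]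
    fps_map_qratio_root[OF nonzero_factors(3,4) complex_alg_hom_reflect_J]
    qnum_quotient_minus
  unfolding qratio_eq[OF nonzero_factors(1,2)] qratio_eq[OF nonzero_factors(3,4)]
  by (simp_all only: mult.commute)

lemma eval_at_values:
  "eval_at m j (pJ + pM + 1) = j + m + 1" "eval_at m j (pJ - pM) = j - m"
  "eval_at m j (pJ + pM) = j + m" "eval_at m j (pJ - pM + 1) = j - m + 1"
  "eval_at m j (pM + 1) = m + 1" "eval_at m j (- pM) = - m"
  by (simp_all add: eval_at_def pJ_def pM_def)

lemma eval_alpha_inv_E:
  "fps_map (eval_at (wt_M k l) (wt_J k l)) alpha_inv_E =
     hexp (wt_M k l + 1) * hsqrt (qnum_quotient (of_nat (Suc l)) * qnum_quotient (of_nat k))"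
proof -
  have "wt_J k l + wt_M k l + 1 = of_nat (Suc l)" "wt_J k l - wt_M k l = of_nat k"
    by (simp_all add: field_simps)
  then show ?thesis
    by (simp only: alpha_inv_E_def fps_map_mult[OF complex_alg_hom_eval_at] eval_at_values
        fps_map_hexp[OF complex_alg_hom_eval_at]
        fps_map_qratio_root[OF nonzero_factors(1,2) complex_alg_hom_eval_at])
qed

lemma eval_alpha_inv_F:
  "fps_map (eval_at (wt_M k l) (wt_J k l)) alpha_inv_F =
     hexp (- wt_M k l) * hsqrt (qnum_quotient (of_nat l) * qnum_quotient (of_nat (Suc k)))"
proof -
  have "wt_J k l + wt_M k l = of_nat l" "wt_J k l - wt_M k l + 1 = of_nat (Suc k)"
    by (simp_all add: field_simps)
  then show ?thesis
    by (simp only: alpha_inv_F_def fps_map_mult[OF complex_alg_hom_eval_at] eval_at_values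
        fps_map_hexp[OF complex_alg_hom_eval_at]
        fps_map_qratio_root[OF nonzero_factors(3,4) complex_alg_hom_eval_at])
qed

text \<open>The squares of the two sides agree, and both constant terms equal \<open>n\<close>.\<close>

lemma match_square_roots:
  fixes p p' Q Q' :: "complex fps"
  assumes squares: "p' * p' * Q' = hexp (2 * d) * (p * p * Q)"
    and 0: "p $ 0 = 1" "p' $ 0 = 1" "Q $ 0 = 1" "Q' $ 0 = 1" and n: "n > 0"
  shows "hexp m * hsqrt (Q' * Q) * (fps_const (of_nat n) * p') =
     p * (hexp (m + d) * (fps_const (of_nat n) * Q))"
proof -
  let ?c = "fps_const (of_nat n :: complex)" and ?s = "hsqrt (Q' * Q)"
  have Q0: "(Q' * Q) $ 0 = cemb (complex_of_real 1)"
    by (simp add: 0 cemb_one)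
  have "(hexp m * ?s * (?c * p')) * (hexp m * ?s * (?c * p')) =
      (?c * ?c) * (hexp m * hexp m) * (p' * p') * (?s * ?s)"
    by (simp only: mult_ac)
  also have "\<dots> = (?c * ?c) * (hexp m * hexp m) * (p' * p' * Q') * Q"
    unfolding hsqrt_mult_self[OF zero_less_one Q0] by (simp only: mult_ac)
  also have "\<dots> = (?c * ?c) * (hexp m * hexp m * hexp (2 * d)) * (p * p * Q) * Q"
    unfolding squares by (simp only: mult_ac)
  also have "hexp m * hexp m * hexp (2 * d) = hexp (m + d) * hexp (m + d)"
    unfolding hexp_complex_add[symmetric] by (simp add: algebra_simps)
  finally have "(hexp m * ?s * (?c * p')) * (hexp m * ?s * (?c * p')) =
      (p * (hexp (m + d) * (?c * Q))) * (p * (hexp (m + d) * (?c * Q)))"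
    by (simp only: mult_ac)
  then show ?thesis
    by (rule positive_root_unique[where r="real n" and s="real n"])
      (use hsqrt_nth_0[OF zero_less_one Q0] n in \<open>simp_all add: 0 hexp_complex cemb_complex_def\<close>)
qed

lemma phi_coeff_E:
  "hexp (wt_M (Suc k) l + 1) * hsqrt (qnum_quotient (of_nat (Suc l)) *
      qnum_quotient (of_nat (Suc k))) *
     (fps_const (of_nat (Suc k)) * phi_coeff k (Suc l)) =
   phi_coeff (Suc k) l * (hexp (of_nat l - of_nat k + 1 / 2) * qnum (of_nat (Suc k)))"
proof -
  have "2 * ((of_nat l - of_nat k) / 2) = (of_nat l - of_nat k :: complex)" by simp
  note * = match_square_roots[of "phi_coeff k (Suc l)" "qnum_quotient (of_nat (Suc l))"
      "(of_nat l - of_nat k) / 2"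
      "phi_coeff (Suc k) l" "qnum_quotient (of_nat (Suc k))" "Suc k" "wt_M (Suc k) l +
          1", unfolded this,
      OF phi_coeff_ratio phi_coeff_nth_0 phi_coeff_nth_0 qnum_quotient_nth_0 qnum_quotient_nth_0
          zero_less_Suc]
  have "wt_M (Suc k) l + 1 + (of_nat l - of_nat k) / 2 = of_nat l - of_nat k + 1 / 2"
    by (simp add: field_simps)
  then show ?thesis
    using * by (simp only: qnum_eq)
qed

lemma phi_coeff_F:
  "hexp (- wt_M k (Suc l)) * hsqrt (qnum_quotient (of_nat (Suc l)) *
      qnum_quotient (of_nat (Suc k))) *
     (fps_const (of_nat (Suc l)) * phi_coeff (Suc k) l) =
   phi_coeff k (Suc l) * (hexp (of_nat k - of_nat l - 1 / 2) * qnum (of_nat (Suc l)))"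
proof -
  have "hexp (of_nat k - of_nat l) * (phi_coeff k (Suc l) * phi_coeff k (Suc l) *
      qnum_quotient (of_nat (Suc l)))
      = (hexp (of_nat k - of_nat l) * hexp (of_nat l - of_nat k)) *
        (phi_coeff (Suc k) l * phi_coeff (Suc k) l * qnum_quotient (of_nat (Suc k)))"
    unfolding phi_coeff_ratio by (simp only: mult.assoc)
  then have ratio: "phi_coeff (Suc k) l * phi_coeff (Suc k) l * qnum_quotient (of_nat (Suc k)) =
      hexp (of_nat k - of_nat l) * (phi_coeff k (Suc l) * phi_coeff k (Suc l) *
          qnum_quotient (of_nat (Suc l)))"
    by (simp add: hexp_complex flip: fps_exp_add_mult)
  have "2 * ((of_nat k - of_nat l) / 2) = (of_nat k - of_nat l :: complex)" by simp
  note * = match_square_roots[of "phi_coeff (Suc k) l" "qnum_quotient (of_nat (Suc k))"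
      "(of_nat k - of_nat l) / 2"
      "phi_coeff k (Suc l)" "qnum_quotient (of_nat (Suc l))" "Suc l"
          "- wt_M k (Suc l)", unfolded this,
      OF ratio phi_coeff_nth_0 phi_coeff_nth_0 qnum_quotient_nth_0 qnum_quotient_nth_0
          zero_less_Suc]
  have "- wt_M k (Suc l) + (of_nat k - of_nat l) / 2 = of_nat k - of_nat l - 1 / 2"
    by (simp add: field_simps)
  then show ?thesis
    using * by (simp only: qnum_eq mult.commute[of "qnum_quotient (of_nat (Suc k))"
        "qnum_quotient (of_nat (Suc l))"])
qed

section \<open>The deformed action on ordered monomials\<close>

lemma qnum_defining:
  "(hexp 1 - hexp (- 1)) * qnum a = hexp a - hexp (- (a::complex))"
proof -
  have shift: "fps_X * fps_shift 1 (hexp b - hexp (- b)) = hexp b - hexp (- b :: complex)" for b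
  proof (rule fps_ext)
    fix n
    show "(fps_X * fps_shift 1 (hexp b - hexp (- b))) $ n = (hexp b - hexp (- b)) $ n"
      by (cases n) (simp_all add: hexp_complex)
  qed
  have "fps_shift 1 (hexp 1 - hexp (- 1 :: complex)) $ 0 \<noteq> 0"
    by (simp add: hexp_complex)
  then have unit: "fps_shift 1 (hexp 1 - hexp (- 1 :: complex)) *
      inverse (fps_shift 1 (hexp 1 - hexp (- 1))) = 1"
    by (metis inverse_mult_eq_1 mult.commute)
  have "(hexp 1 - hexp (- 1)) * qnum a =
      (fps_X * fps_shift 1 (hexp a - hexp (- a))) *
      (fps_shift 1 (hexp 1 - hexp (- 1)) * inverse (fps_shift 1 (hexp 1 - hexp (- 1))))"
    by (subst shift[of 1, symmetric]) (simp only: qnum_def hemb_complex mult_ac)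
  then show ?thesis
    unfolding unit shift by simp
qed

lemma
  fixes a :: complex
  shows qnum_add_one: "qnum (a + 1) = hexp (- a) + hexp 1 * qnum a"
    and qnum_add_one': "qnum (a + 1) = hexp a + hexp (- 1) * qnum a"
proof -
  have exps: "hexp (a + 1) = hexp a * hexp 1" "hexp (- (a + 1)) = hexp (- a) * hexp (- 1)"
    using hexp_complex_add[of a 1] hexp_complex_add[of "- a" "- 1"] by simp_all
  let ?D = "hexp 1 - hexp (- 1 :: complex)"
  have "?D $ 1 \<noteq> 0" by (simp add: hexp_complex)
  then have D: "?D \<noteq> 0" by (metis fps_zero_nth)
  have "?D * qnum (a + 1) = ?D * hexp (- a) + hexp 1 * (?D * qnum a)"
    "?D * qnum (a + 1) = ?D * hexp a + hexp (- 1) * (?D * qnum a)"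
    unfolding qnum_defining exps by (simp_all add: algebra_simps)
  then have "?D * qnum (a + 1) = ?D * (hexp (- a) + hexp 1 * qnum a)"
    "?D * qnum (a + 1) = ?D * (hexp a + hexp (- 1) * qnum a)"
    by (simp_all only: distrib_left mult.left_commute)
  then show "qnum (a + 1) = hexp (- a) + hexp 1 * qnum a"
    "qnum (a + 1) = hexp a + hexp (- 1) * qnum a"
    by (simp_all only: mult_left_cancel[OF D])
qed

lemma qnum_zero [simp]: "qnum 0 = (0 :: complex fps)"
  by (simp add: qnum_eq)

lemma hscale_add_left: "hscale (s + t) a = hscale s a + hscale t a"
  by (simp add: hscale_def hemb_add distrib_right)

lemma hscale_const_add:
  "hscale (fps_const (c + d)) a = hscale (fps_const c) a + hscale (fps_const d) a"
  by (simp only: fps_const_add[symmetric] hscale_add_left)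

lemma hscale_zero [simp]: "hscale 0 a = 0" "hscale s 0 = 0"
  by (simp_all add: hscale_def)

lemma hscale_minus_one: "hscale (fps_const (- 1)) a = - a"
proof -
  have "hscale (fps_const (- 1)) a + hscale 1 a = hscale (fps_const (- 1) + 1) a"
    by (simp only: hscale_add_left)
  also have "fps_const (- 1) + 1 = (0 :: complex fps)"
    by (simp flip: fps_const_1_eq_1)
  finally show ?thesis by (simp add: eq_neg_iff_add_eq_0)
qed

lemma module_hom_hscale_left: "module_hom hscale hscale (\<lambda>s :: complex fps. hscale s a)"
  by (rule module_hom_hscaleI) (simp_all add: hscale_add_left hscale_hscale, simp add: hscale_def
      hemb_mult mult.assoc)

lemma abs_uh_mult: "abs_uh (a * b) = abs_uh a * abs_uh b"
  by (simp add: times_uh.abs_eq)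

locale quantum_plane =
  fixes r :: "uh \<Rightarrow> xh \<Rightarrow> xh"
  assumes action: "quantum_plane_action r"
begin

abbreviation (input) "H \<equiv> uhgen GenH"
abbreviation (input) "E \<equiv> uhgen GenE"
abbreviation (input) "F \<equiv> uhgen GenF"
abbreviation (input) "X \<equiv> xhgen GenX"
abbreviation (input) "Y \<equiv> xhgen GenY"

lemma action_linear: "module_hom hscale hscale (\<lambda>u. r u p)" "module_hom hscale hscale (r u)"
  and action_one: "r 1 p = p"
  and action_mult: "r (u * v) p = r u (r v p)"
  and action_unit: "r (uhgen g) 1 = 0"
  and action_generators: "r H X = - X" "r H Y = Y" "r E X = hscale (hexp (1 / 2)) Y" "r E Y = 0"
    "r F Y = hscale (hexp (- 1 / 2)) X" "r F X = 0"
  and H_mult: "r H (p * p') = r H p * p' + p * r H p'"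
  and E_mult: "r E (p * p') = r E p * r uh_expH p' + p * r E p'"
  and F_mult: "r F (p * p') = r F p * p' + r uh_exp_minusH p * r F p'"
  using action unfolding quantum_plane_action_def hbar_action_def by blast+

lemmas action_hscale = module_hom_hscale[OF action_linear(2)] module_hom_hscale[OF action_linear(1)]

text \<open>On an eigenvector the \<open>i\<close>-th coefficient of \<open>e\<^bsup>\<hbar>h\<^esup>\<close> acts as the \<open>i\<close>-th coefficient of
  \<open>e\<^bsup>\<hbar>c\<^esup>\<close>, and \<open>hbar_additive_eqI\<close> compares the two series.\<close>

lemma action_exp:
  assumes h: "r (abs_uh (fps_const h)) v = hscale (fps_const c) v"
  shows "r (abs_uh (hexp h)) v = hscale (hexp c) v"
proof (rule hbar_additive_eqI)
  show "hbar_additive (\<lambda>a. r (abs_uh a) v)"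
    by (intro hbar_additive_module_hom module_hom_hscale_compose[OF action_linear(1)
        module_hom_abs_uh])
  show "hbar_additive (\<lambda>s :: complex fps. hscale s v)"
    by (intro hbar_additive_module_hom module_hom_hscale_left)
  fix i
  have "r (abs_uh (fps_const (h ^ i))) v = hscale (fps_const (c ^ i)) v"
  proof (induction i)
    case 0
    show ?case by (simp add: action_one flip: one_uh.abs_eq)
  next
    case (Suc i)
    then show ?case
      by (simp add: abs_uh_mult action_mult action_hscale h hscale_hscale mult.commute flip:
          fps_const_mult)
  qed
  moreover have "hexp h $ i = cemb (1 / fact i) * h ^ i" "hexp c $ i = 1 / fact i * c ^ i"
    by (simp_all add: hexp_def cemb_complex_def)
  ultimately show "r (abs_uh (fps_const (hexp h $ i))) v = hscale (fps_const (hexp c $ i)) v"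
    by (simp only: module_hom_hscale[OF module_hom_abs_uh]
        action_hscale hscale_hscale fps_const_mult
        flip: hscale_fps_const)
qed

lemma H_X_power: "r H (X ^ k) = hscale (fps_const (- of_nat k)) (X ^ k)"
proof (induction k)
  case (Suc k)
  have "r H (X ^ Suc k) = hscale (fps_const (- 1)) (X ^ Suc k) +
      hscale (fps_const (- of_nat k)) (X ^ Suc k)"
    by (simp add: H_mult action_generators Suc hscale_mult_right hscale_minus_one del:
        fps_const_neg)
  then show ?case
    by (simp flip: hscale_const_add)
qed (simp add: action_unit)

lemma H_Y_power: "r H (Y ^ l) = hscale (fps_const (of_nat l)) (Y ^ l)"
proof (induction l)
  case (Suc l)
  have "r H (Y ^ Suc l) = hscale (fps_const 1) (Y ^ Suc l) +
      hscale (fps_const (of_nat l)) (Y ^ Suc l)"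
    by (simp add: H_mult action_generators Suc hscale_mult_right)
  then show ?case
    by (simp del: fps_const_1_eq_1 flip: hscale_const_add)
qed (simp add: action_unit)

lemma exp_H_eigenvector:
  assumes "r H v = hscale (fps_const c) v"
  shows "r uh_expH v = hscale (hexp c) v" and "r uh_exp_minusH v = hscale (hexp (- c)) v"
proof -
  show "r uh_expH v = hscale (hexp c) v"
    unfolding uh_expH_def using assms by (intro action_exp) (simp add: uhgen_def)
  have "fps_const (- gen GenH) = hscale (fps_const (- 1)) (fps_const (gen GenH))"
    by (simp only: hscale_minus_one fps_const_neg)
  then have "r (abs_uh (fps_const (- gen GenH))) v = hscale (fps_const (- c)) v"
    using assms by (simp add: module_hom_hscale[OF module_hom_abs_uh]
        action_hscale hscale_hscale uhgen_def
        del: hscale_fps_const fps_const_neg)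
  then show "r uh_exp_minusH v = hscale (hexp (- c)) v"
    unfolding uh_exp_minusH_def by (rule action_exp)
qed

text \<open>Each of the \<open>k\<close> factors \<open>x\<close> in turn becomes \<open>y\<close>, and \<open>e\<^bsup>\<hbar>H\<^esup>\<close> together with the
  reordering yields a geometric progression which sums to a quantum number. For \<open>k = 0\<close> the
  right-hand side vanishes because \<open>[0] = 0\<close>, whatever the truncated exponent \<open>k - 1\<close>.\<close>

lemma E_X_power: "r E (X ^ k) = hscale (hexp (3 / 2 - of_nat k) * qnum (of_nat k)) (X ^ (k - 1) *
    Y)"
proof (induction k)
  case 0
  show ?case by (simp add: action_unit)
next
  case (Suc k)
  let ?s = "hexp (3 / 2 - of_nat k) * qnum (of_nat k) :: complex fps"
  have "r E (X ^ Suc k) = hscale (hexp (1 / 2) * hexp (- of_nat k)) (Y * X ^ k) + X *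
      hscale ?s (X ^ (k - 1) * Y)"
    by (simp add: E_mult action_generators exp_H_eigenvector[OF H_X_power]
        Suc hscale_mult_left hscale_mult_right hscale_hscale mult.commute)
  also have "X * hscale ?s (X ^ (k - 1) * Y) = hscale ?s (X ^ k * Y)"
    by (cases k) (simp_all add: hscale_mult_right mult.assoc)
  also have "hscale (hexp (1 / 2) * hexp (- of_nat k)) (Y * X ^ k) =
      hscale (hexp (1 / 2) * hexp (- of_nat k) * hexp (- of_nat k)) (X ^ k * Y)"
    by (simp add: xhgen_Y_X_power hscale_hscale)
  also have "hscale (hexp (1 / 2) * hexp (- of_nat k) * hexp (- of_nat k)) (X ^ k * Y) +
      hscale ?s (X ^ k * Y) =
      hscale (hexp (1 / 2) * hexp (- of_nat k) * hexp (- of_nat k) + ?s) (X ^ k * Y)"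
    by (simp only: hscale_add_left)
  also have "hexp (1 / 2) * hexp (- of_nat k) * hexp (- of_nat k) + ?s =
      hexp (3 / 2 - of_nat (Suc k)) * qnum (of_nat (Suc k))"
  proof -
    have "hexp (3 / 2 - of_nat (Suc k)) = hexp (1 / 2) * hexp (- of_nat k :: complex)"
      "hexp (3 / 2 - of_nat k) = hexp (1 / 2) * hexp (- of_nat k) * hexp (1 :: complex)"
      unfolding hexp_complex_add[symmetric] by simp_all
    moreover have "qnum (of_nat (Suc k)) = hexp (- of_nat k) + hexp 1 * qnum (of_nat k :: complex)"
      using qnum_add_one[of "of_nat k"] by (simp add: add.commute)
    ultimately show ?thesis by (simp only: distrib_left mult.assoc)
  qed
  finally show ?case by simp
qed

lemma F_Y_power: "r F (Y ^ l) = hscale (hexp (1 / 2 - of_nat l) * qnum (of_nat l)) (X *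
    Y ^ (l - 1))"
proof (induction l)
  case 0
  show ?case by (simp add: action_unit)
next
  case (Suc l)
  let ?s = "hexp (1 / 2 - of_nat l) * qnum (of_nat l) :: complex fps"
  have "r H Y = hscale (fps_const 1) Y"
    by (simp add: action_generators)
  note expY = exp_H_eigenvector(2)[OF this]
  have "r F (Y ^ Suc l) = hscale (hexp (- 1 / 2)) (X * Y ^ l) + hscale (hexp (- 1)) (Y *
      hscale ?s (X * Y ^ (l - 1)))"
    by (simp add: F_mult action_generators expY Suc hscale_mult_left)
  also have "Y * hscale ?s (X * Y ^ (l - 1)) = hscale (?s * hexp (- 1)) (X * Y * Y ^ (l - 1))"
    using xhgen_Y_X_power[of 1]
        by (simp add: hscale_mult_right hscale_mult_left hscale_hscale flip: mult.assoc)
  also have "\<dots> = hscale (?s * hexp (- 1)) (X * Y ^ l)"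
    by (cases l) (simp_all add: mult.assoc)
  also have "hscale (hexp (- 1 / 2)) (X * Y ^ l) + hscale (hexp (- 1)) \<dots> =
      hscale (hexp (- 1 / 2) + hexp (- 1) * (?s * hexp (- 1))) (X * Y ^ l)"
    by (simp only: hscale_add_left hscale_hscale)
  also have "hexp (- 1 / 2) + hexp (- 1) * (?s * hexp (- 1)) =
      hexp (1 / 2 - of_nat (Suc l)) * qnum (of_nat (Suc l))"
  proof -
    have "hexp (- 1 / 2) = hexp (1 / 2 - of_nat (Suc l)) * hexp (of_nat l :: complex)"
      "hexp (1 / 2 - of_nat l) * hexp (- 1) = hexp (1 / 2 - of_nat (Suc l) :: complex)"
      unfolding hexp_complex_add[symmetric] by simp_all
    moreover have "qnum (of_nat (Suc l)) = hexp (of_nat l) + hexp (- 1) *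
        qnum (of_nat l :: complex)"
      using qnum_add_one'[of "of_nat l"] by (simp add: add.commute)
    ultimately show ?thesis by (simp add: distrib_left mult_ac)
  qed
  finally show ?case by simp
qed

lemma E_Y_power: "r E (Y ^ l) = 0"
  by (induction l) (simp_all add: action_unit E_mult action_generators)

lemma F_X_power: "r F (X ^ k) = 0"
proof (induction k)
  case (Suc k)
  show ?case
    unfolding power_Suc F_mult action_generators Suc by simp
qed (simp add: action_unit)

lemma H_ordered: "r H (X ^ k * Y ^ l) = hscale (fps_const (of_nat l - of_nat k)) (X ^ k * Y ^ l)"
proof -
  have "r H (X ^ k * Y ^ l) = hscale (fps_const (- of_nat k)) (X ^ k * Y ^ l) +
      hscale (fps_const (of_nat l)) (X ^ k * Y ^ l)"
    by (simp only: H_mult H_X_power H_Y_power hscale_mult_left hscale_mult_right)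
  then show ?thesis
    by (simp flip: hscale_const_add)
qed

lemma E_ordered: "r E (X ^ k * Y ^ l) =
    hscale (hexp (of_nat l - of_nat k + 3 / 2) * qnum (of_nat k)) (X ^ (k - 1) * Y ^ Suc l)"
proof -
  have exps: "hexp (of_nat l) * hexp (3 / 2 - of_nat k) = hexp (of_nat l - of_nat k +
      3 / 2 :: complex)"
    unfolding hexp_complex_add[symmetric] by (simp add: algebra_simps)
  show ?thesis
    by (simp add: E_mult E_Y_power E_X_power exp_H_eigenvector[OF H_Y_power]
        hscale_mult_left hscale_mult_right
        hscale_hscale mult.assoc) (simp only: exps[symmetric] mult_ac)
qed

lemma F_ordered: "r F (X ^ k * Y ^ l) =
    hscale (hexp (of_nat k - of_nat l + 1 / 2) * qnum (of_nat l)) (X ^ Suc k * Y ^ (l - 1))"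
proof -
  have exps: "hexp (of_nat k) * hexp (1 / 2 - of_nat l) = hexp (of_nat k - of_nat l +
      1 / 2 :: complex)"
    unfolding hexp_complex_add[symmetric] by (simp add: algebra_simps)
  show ?thesis
    using power_commutes[of X k]
    by (simp add: F_mult F_Y_power F_X_power exp_H_eigenvector[OF H_X_power]
        hscale_mult_left hscale_mult_right
        hscale_hscale flip: mult.assoc) (simp only: exps[symmetric] mult_ac)
qed

end

section \<open>Equivariance\<close>

lemma module_hom_inv:
  assumes f: "module_hom hscale hscale f" and "bij f"
  shows "module_hom hscale hscale (inv f)"
proof (rule module_hom_hscaleI)
  have inv: "f (inv f a) = a" "inv f (f b) = b" for a b
    using \<open>bij f\<close> by (simp_all add: bij_is_surj surj_f_inv_f bij_is_inj)
  show "inv f (a + b) = inv f a + inv f b" for a b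
    using module_hom_add[OF f, of "inv f a" "inv f b"] by (metis inv)
  show "inv f (hscale s a) = hscale s (inv f a)" for s a
    using module_hom_hscale[OF f, of s "inv f a"] by (metis inv)
qed

context quantum_plane
begin

text \<open>Both sides are multiples of the same ordered monomial; \<open>phi_coeff_E\<close> and \<open>phi_coeff_F\<close>
  compare the scalars. Where \<open>E\<close> or \<open>F\<close> annihilates the monomial, both sides vanish.\<close>

lemma intertwines_on_monomial:
  assumes "is_alpha \<alpha>"
  shows "r (uhgen g) (phi (fps_const (px ^ k * py ^ l))) =
    phi (rho (inv \<alpha> (uhgen g)) (fps_const (px ^ k * py ^ l)))"
proof -
  let ?w = "fps_const (px ^ k * py ^ l)"
  have alpha: "inv \<alpha> E = fps_const (ugen GenE) * heval_MJ alpha_inv_E"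
    "inv \<alpha> F = fps_const (ugen GenF) * heval_MJ alpha_inv_F" "inv \<alpha> H = fps_const (ugen GenH)"
    using assms by (simp_all add: is_alpha_def alpha_inv_E_def alpha_inv_F_def)
  have lhs: "r u (phi ?w) = hscale (phi_coeff k l) (r u (X ^ k * Y ^ l))" for u
    by (simp only: phi_monomial action_hscale)
  have rho_const: "rho (fps_const a) (fps_const p) = fps_const (usl2_act a p)" for a p
    by (simp add: rho_fps_const fps_eq_iff)
  have rhs: "phi (rho (fps_const a * heval_MJ f) ?w) =
      hscale (fps_map (eval_at (wt_M k l) (wt_J k l)) f) (phi (fps_const (usl2_act a (px ^ k *
          py ^ l))))"
    if "fps_map reflect_J f = f" for a f
    by (simp only: rho_mult rho_heval_MJ[OF that] module_hom_hscale[OF module_hom_rho_arg]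
        module_hom_hscale[OF module_hom_phi] rho_const)
  have phi_scaled: "phi (fps_const (cemb c * (px ^ i * py ^ j))) =
      hscale (fps_const c * phi_coeff i j) (X ^ i * Y ^ j)" for c i j
    by (simp only: hscale_fps_const[symmetric] module_hom_hscale[OF module_hom_phi]
        phi_monomial hscale_hscale)
  show ?thesis
  proof (cases g)
    case GenE
    show ?thesis
    proof (cases k)
      case 0
      then show ?thesis
        unfolding GenE lhs alpha rhs[OF reflect_J_alpha_inv(1)] E_monomial phi_scaled E_ordered
            by simp
    next
      case (Suc n)
      have "hexp (of_nat l - of_nat (Suc n) + 3 / 2) = hexp (of_nat l - of_nat n +
          1 / 2 :: complex)"
        by (simp add: add.commute)
      then show ?thesis
        unfolding GenE lhs alpha rhs[OF reflect_J_alpha_inv(1)] E_monomial phi_scaled E_ordered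
          eval_alpha_inv_E hscale_hscale unfolding Suc diff_Suc_1
        by (simp only: phi_coeff_E)
    qed
  next
    case GenF
    show ?thesis
    proof (cases l)
      case 0
      then show ?thesis
        unfolding GenF lhs alpha rhs[OF reflect_J_alpha_inv(2)] F_monomial phi_scaled F_ordered
            by simp
    next
      case (Suc n)
      have "hexp (of_nat k - of_nat (Suc n) + 1 / 2) =
          hexp (of_nat k - of_nat n - 1 / 2 :: complex)"
        by simp
      then show ?thesis
        unfolding GenF lhs alpha rhs[OF reflect_J_alpha_inv(2)] F_monomial phi_scaled F_ordered
          eval_alpha_inv_F hscale_hscale unfolding Suc diff_Suc_1
        by (simp only: phi_coeff_F)
    qed
  next
    case GenH
    show ?thesis
      unfolding GenH lhs alpha rho_const H_monomial phi_scaled H_ordered hscale_hscale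
      by (simp only: mult.commute)
  qed
qed

text \<open>Stated for \<open>v = \<alpha>(u)\<close>, because the deformed algebra is generated by the three elements
  on which \<open>\<alpha>\<^bsup>-1\<^esup>\<close> is known: the identity passes from generators to words by
  multiplicativity, and from words to series of linear combinations by linearity.\<close>

lemma intertwines:
  assumes alpha: "is_alpha \<alpha>"
  shows "r v (phi p) = phi (rho (inv \<alpha> v) p)"
proof -
  let ?b = "inv \<alpha>"
  have iso: "module_hom hscale hscale \<alpha>" "bij \<alpha>" "\<alpha> 1 = 1" "\<And>a b. \<alpha> (a * b) = \<alpha> a * \<alpha> b"
    using alpha by (auto simp: is_alpha_def hbar_alg_iso_def)
  have inv: "\<alpha> (?b a) = a" "?b (\<alpha> c) = c" for a c
    using iso(2) by (simp_all add: bij_is_surj surj_f_inv_f bij_is_inj)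
  have hom: "module_hom hscale hscale ?b"
    by (rule module_hom_inv[OF iso(1,2)])
  have one: "?b 1 = 1" by (metis inv(2) iso(3))
  have mult: "?b (a * c) = ?b a * ?b c" for a c
    using iso(4)[of "?b a" "?b c"] by (metis inv)
  have gens: "r (uhgen g) (phi p) = phi (rho (?b (uhgen g)) p)" for g p
    by (rule module_hom_xy_eqI[OF module_hom_hscale_compose[OF action_linear(2) module_hom_phi]
          module_hom_hscale_compose[OF module_hom_phi module_hom_rho_arg]
              intertwines_on_monomial[OF alpha]])
  have words: "r (abs_uh (fps_const (Poly_Mapping.single (FWord w) 1))) (phi p) =
      phi (rho (?b (abs_uh (fps_const (Poly_Mapping.single (FWord w) 1)))) p)" for w p
  proof (induction w)
    case Nil
    have "rho 1 p = p"
      using rho_fps_const[of 1 p] usl2_act_cemb[of 1] by (simp add: cemb_one fps_eq_iff)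
    then show ?case
      by (simp add: single_Nil one action_one flip: one_uh.abs_eq)
  next
    case (Cons g w)
    have "abs_uh (fps_const (Poly_Mapping.single (FWord (g # w)) 1)) =
        uhgen g * abs_uh (fps_const (Poly_Mapping.single (FWord w) 1))"
      unfolding single_Cons uhgen_def fps_const_mult[symmetric] abs_uh_mult ..
    then show ?case
      by (simp only: action_mult Cons gens mult rho_mult)
  qed
  obtain a where "v = abs_uh a"
    by (metis Quotient3_abs_rep Quotient3_uh)
  moreover have "r (abs_uh a) (phi p) = phi (rho (?b (abs_uh a)) p)"
    by (rule module_hom_words_eqI[of "\<lambda>a. r (abs_uh a) (phi p)" "\<lambda>a. phi (rho (?b (abs_uh a)) p)"])
      (rule module_hom_hscale_compose[OF action_linear(1) module_hom_abs_uh]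
        module_hom_hscale_compose[OF module_hom_phi module_hom_hscale_compose[OF module_hom_rho
          module_hom_hscale_compose[OF hom module_hom_abs_uh]]] words)+
  ultimately show ?thesis by simp
qed

end

theorem mainTheorem2:
  fixes \<alpha> :: "usl2 fps \<Rightarrow> uh" and \<rho>\<^sub>h :: "uh \<Rightarrow> xh \<Rightarrow> xh"
  assumes "is_alpha \<alpha>" and "quantum_plane_action \<rho>\<^sub>h"
  shows "module_hom hscale hscale phi \<and> bij phi \<and>
    (\<forall>u p. inv phi (\<rho>\<^sub>h (\<alpha> u) (phi p)) = rho u p)"
proof (intro conjI allI)
  fix u p
  interpret quantum_plane \<rho>\<^sub>h by standard (rule assms(2))
  have "inj \<alpha>"
    using assms(1) by (simp add: is_alpha_def hbar_alg_iso_def bij_is_inj)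
  then have "\<rho>\<^sub>h (\<alpha> u) (phi p) = phi (rho u p)"
    using intertwines[OF assms(1), of "\<alpha> u" p] by simp
  then show "inv phi (\<rho>\<^sub>h (\<alpha> u) (phi p)) = rho u p"
    by (simp add: inj_phi)
qed (rule module_hom_phi, rule bij_phi)

end
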